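(* Let $L=(L_1,L_1',L_2,L_2')\in\mathbb{R}^4$ satisfy $L_1'<L_1$ and $L_2'<L_2$. Let $\rho^0\in L^1(\mathbb{R}^2)$ with $\rho^0\ge 0$ have compact support included in $C_L=[L_1',L_1]\times[L_2',L_2]$, and assume $\partial_x\rho^0,\partial_y\rho^0\in L^\infty(\mathbb{R}^2)$. For every integer $N\ge 1$ let $\hat\rho^N$ be the piecewise constant density associated with $\rho^0$, $L$, $N$ (defined in the context). Then for every $\varphi\in C_c^\infty(\mathbb{R}^2)$ and every $N\geq 1$, $$\left|\iint_{\mathbb{R}^2}\hat\rho^N(x,y)\varphi(x,y)\,dx\,dy-\iint_{\mathbb{R}^2}\rho^0(x,y)\varphi(x,y)\,dx\,dy\right|\le\frac{C_{1,2}(\varphi)}{N^2},$$ where $$C_{1,2}(\varphi)=\max(\Delta_1,\Delta_2)^4\,(\|\partial_x\rho^0\|_\infty+\|\partial_y\rho^0\|_\infty)(\|\partial_x\varphi\|_\infty+\|\partial_y\varphi\|_\infty).$$ Moreover, let $\omega^0\in L^\infty(\mathbb{R}^2)$ be such that $\partial_x\omega^0,\partial_y\omega^0\in L^\infty(\mathbb{R}^2)$, and let $\hat\rho^N\hat\omega^N$ be the associated piecewise constant quantity (defined in the context). Then for every $\varphi\in C_c^\infty(\mathbb{R}^2)$ and every $N\ge 1$, $$\left|\iint_{\mathbb{R}^2}(\hat\rho^N\hat\omega^N)(x,y)\varphi(x,y)\,dx\,dy-\iint_{\mathbb{R}^2}\rho^0(x,y)\omega^0(x,y)\varphi(x,y)\,dx\,dy\right|\le\frac{K_{1,2}(\varphi)}{N}+\frac{C_{1,2}(\varphi)\|\omega^0\|_\infty}{N^2},$$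 where $$K_{1,2}(\varphi)=\max(\Delta_1,\Delta_2)\,(\|\partial_x\omega^0\|_\infty+\|\partial_y\omega^0\|_\infty)\,\|\varphi\|_\infty\,\|\rho^0\|_1.$$
   Context: Notation: $\Delta_1=L_1-L_1'$, $\Delta_2=L_2-L_2'$. For an integer $N\ge1$ and $k\in\{0,\dots,N\}$, $\overline{x}_k^N=L_1'+k\frac{\Delta_1}{N}$ and $\overline{y}_k^N=L_2'+k\frac{\Delta_2}{N}$. For $i,j\in\{0,\dots,N-1\}$, $$a_{i,j}^N=\frac{N^2}{\Delta_1\Delta_2}\int_{\overline{x}_i^N}^{\overline{x}_{i+1}^N}\int_{\overline{y}_j^N}^{\overline{y}_{j+1}^N}\rho^0(x,y)\,dy\,dx,\qquad W_{i,j}^N=\frac{N^2}{\Delta_1\Delta_2}\int_{\overline{x}_i^N}^{\overline{x}_{i+1}^N}\int_{\overline{y}_j^N}^{\overline{y}_{j+1}^N}\omega^0(x,y)\,dy\,dx.$$ The piecewise constant density is $$\hat\rho^N(x,y)=\sum_{i=0}^{N-1}\sum_{j=0}^{N-1}a_{i,j}^N\,\mathbf{1}_{[\overline{x}_i^N,\overline{x}_{i+1}^N[}(x)\,\mathbf{1}_{[\overline{y}_j^N,\overline{y}_{j+1}^N[}(y),$$ and the piecewise constant quantity $\hat\rho^N\hat\omega^N$ (a single function) is $$(\hat\rho^N\hat\omega^N)(x,y)=\sum_{i=0}^{N-1}\sum_{j=0}^{N-1}a_{i,j}^N W_{i,j}^N\,\mathbf{1}_{[\overline{x}_i^N,\overline{x}_{i+1}^N[}(x)\,\mathbf{1}_{[\overline{y}_j^N,\overline{y}_{j+1}^N[}(y).$$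 $\|\cdot\|_1$ and $\|\cdot\|_\infty$ are the norms of $L^1(\mathbb{R}^2)$ and $L^\infty(\mathbb{R}^2)$. Partial derivatives of $\rho^0,\omega^0$ are weak derivatives. *)

theory Defs
  imports "HOL-Analysis.Analysis" "HOL-Probability.Essential_Supremum"
begin

section \<open>Test functions and weak derivatives on the plane\<close>

definition pd_x :: "(real \<times> real \<Rightarrow> real) \<Rightarrow> real \<times> real \<Rightarrow> real" where
  "pd_x f = (\<lambda>(x, y). deriv (\<lambda>s. f (s, y)) x)"

definition pd_y :: "(real \<times> real \<Rightarrow> real) \<Rightarrow> real \<times> real \<Rightarrow> real" where
  "pd_y f = (\<lambda>(x, y). deriv (\<lambda>t. f (x, t)) y)"

text \<open>\<open>Ck k f\<close>: all iterated partial derivatives of \<open>f\<close> of order up to \<open>k\<close>, in any order of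
  differentiation, exist everywhere and are continuous. The differentiability clauses are needed
  because \<^const>\<open>deriv\<close> is total.\<close>

primrec Ck :: "nat \<Rightarrow> (real \<times> real \<Rightarrow> real) \<Rightarrow> bool" where
  "Ck 0 f \<longleftrightarrow> continuous_on UNIV f"
| "Ck (Suc k) f \<longleftrightarrow>
     continuous_on UNIV f \<and>
     (\<forall>x y. (\<lambda>s. f (s, y)) field_differentiable at x) \<and>
     (\<forall>x y. (\<lambda>t. f (x, t)) field_differentiable at y) \<and>
     Ck k (pd_x f) \<and> Ck k (pd_y f)"

definition Cc_smooth :: "(real \<times> real \<Rightarrow> real) set" where
  "Cc_smooth = {f. (\<forall>k. Ck k f) \<and> compact (closure {z. f z \<noteq> 0})}"

definition locally_integrable :: "(real \<times> real \<Rightarrow> real) \<Rightarrow> bool" where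
  "locally_integrable f \<longleftrightarrow> (\<forall>K. compact K \<longrightarrow> set_integrable lebesgue K f)"

definition weak_pd_x :: "(real \<times> real \<Rightarrow> real) \<Rightarrow> (real \<times> real \<Rightarrow> real) \<Rightarrow> bool" where
  "weak_pd_x f g \<longleftrightarrow> locally_integrable f \<and> locally_integrable g \<and>
     (\<forall>\<phi>\<in>Cc_smooth. (LINT z|lebesgue. f z * pd_x \<phi> z) = - (LINT z|lebesgue. g z * \<phi> z))"

definition weak_pd_y :: "(real \<times> real \<Rightarrow> real) \<Rightarrow> (real \<times> real \<Rightarrow> real) \<Rightarrow> bool" where
  "weak_pd_y f g \<longleftrightarrow> locally_integrable f \<and> locally_integrable g \<and>
     (\<forall>\<phi>\<in>Cc_smooth. (LINT z|lebesgue. f z * pd_y \<phi> z) = - (LINT z|lebesgue. g z * \<phi> z))"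


section \<open>Lebesgue spaces and supports\<close>

definition L1_norm :: "(real \<times> real \<Rightarrow> real) \<Rightarrow> real" where
  "L1_norm f = (LINT z|lebesgue. \<bar>f z\<bar>)"

definition Linf :: "(real \<times> real \<Rightarrow> real) set" where
  "Linf = {f \<in> borel_measurable lebesgue. esssup lebesgue (\<lambda>z. ereal \<bar>f z\<bar>) < \<infinity>}"

text \<open>Meaningful for elements of \<^const>\<open>Linf\<close> only, since \<^const>\<open>real_of_ereal\<close> sends
  \<open>\<infinity>\<close> to \<open>0\<close>.\<close>

definition Linf_norm :: "(real \<times> real \<Rightarrow> real) \<Rightarrow> real" where
  "Linf_norm f = real_of_ereal (esssup lebesgue (\<lambda>z. ereal \<bar>f z\<bar>))"

text \<open>The support of the almost-everywhere class of \<open>f\<close>: the complement of the largest open set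
  on which \<open>f\<close> vanishes almost everywhere.\<close>

definition ess_support :: "(real \<times> real \<Rightarrow> real) \<Rightarrow> (real \<times> real) set" where
  "ess_support f = - \<Union>{U. open U \<and> (AE z in lebesgue. z \<in> U \<longrightarrow> f z = 0)}"


section \<open>Piecewise constant approximations\<close>

text \<open>\<open>grid a' a N k\<close> is the \<open>k\<close>-th node of the uniform subdivision of \<open>[a', a]\<close> into \<open>N\<close> cells.
  Throughout, the arguments \<open>L1 L1' L2 L2'\<close> describe the rectangle \<open>[L1', L1] \<times> [L2', L2]\<close>: the
  primed numbers are the lower ends.\<close>

definition grid :: "real \<Rightarrow> real \<Rightarrow> nat \<Rightarrow> nat \<Rightarrow> real" where
  "grid a' a N k = a' + real k * ((a - a') / real N)"

definition cell_mean ::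
  "real \<Rightarrow> real \<Rightarrow> real \<Rightarrow> real \<Rightarrow> (real \<times> real \<Rightarrow> real) \<Rightarrow> nat \<Rightarrow> nat \<Rightarrow> nat \<Rightarrow> real" where
  "cell_mean L1 L1' L2 L2' f N i j =
     (real N)\<^sup>2 / ((L1 - L1') * (L2 - L2')) *
     (LINT x:{grid L1' L1 N i .. grid L1' L1 N (i + 1)}|lebesgue.
       (LINT y:{grid L2' L2 N j .. grid L2' L2 N (j + 1)}|lebesgue. f (x, y)))"

definition rho_hat ::
  "real \<Rightarrow> real \<Rightarrow> real \<Rightarrow> real \<Rightarrow> (real \<times> real \<Rightarrow> real) \<Rightarrow> nat \<Rightarrow> real \<times> real \<Rightarrow> real" where
  "rho_hat L1 L1' L2 L2' \<rho> N = (\<lambda>(x, y).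
     \<Sum>i<N. \<Sum>j<N. cell_mean L1 L1' L2 L2' \<rho> N i j
       * indicator {grid L1' L1 N i ..< grid L1' L1 N (i + 1)} x
       * indicator {grid L2' L2 N j ..< grid L2' L2 N (j + 1)} y)"

definition rho_omega_hat ::
  "real \<Rightarrow> real \<Rightarrow> real \<Rightarrow> real \<Rightarrow> (real \<times> real \<Rightarrow> real) \<Rightarrow> (real \<times> real \<Rightarrow> real) \<Rightarrow> nat
     \<Rightarrow> real \<times> real \<Rightarrow> real" where
  "rho_omega_hat L1 L1' L2 L2' \<rho> \<omega> N = (\<lambda>(x, y).
     \<Sum>i<N. \<Sum>j<N. cell_mean L1 L1' L2 L2' \<rho> N i j * cell_mean L1 L1' L2 L2' \<omega> N i j
       * indicator {grid L1' L1 N i ..< grid L1' L1 N (i + 1)} x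
       * indicator {grid L2' L2 N j ..< grid L2' L2 N (j + 1)} y)"


section \<open>The constants of the error bounds\<close>

text \<open>The weak derivatives of the data are passed as separate arguments: \<open>\<rho>x\<close>, \<open>\<rho>y\<close> stand for
  those of the density, \<open>\<omega>x\<close>, \<open>\<omega>y\<close> for those of \<open>\<omega>\<close>.\<close>

definition C12 ::
  "real \<Rightarrow> real \<Rightarrow> real \<Rightarrow> real \<Rightarrow> (real \<times> real \<Rightarrow> real) \<Rightarrow> (real \<times> real \<Rightarrow> real)
     \<Rightarrow> (real \<times> real \<Rightarrow> real) \<Rightarrow> real" where
  "C12 L1 L1' L2 L2' \<rho>x \<rho>y \<phi> =
     (max (L1 - L1') (L2 - L2')) ^ 4 * (Linf_norm \<rho>x + Linf_norm \<rho>y)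
       * (Linf_norm (pd_x \<phi>) + Linf_norm (pd_y \<phi>))"

definition K12 ::
  "real \<Rightarrow> real \<Rightarrow> real \<Rightarrow> real \<Rightarrow> (real \<times> real \<Rightarrow> real) \<Rightarrow> (real \<times> real \<Rightarrow> real)
     \<Rightarrow> (real \<times> real \<Rightarrow> real) \<Rightarrow> (real \<times> real \<Rightarrow> real) \<Rightarrow> real" where
  "K12 L1 L1' L2 L2' \<rho> \<omega>x \<omega>y \<phi> =
     max (L1 - L1') (L2 - L2') * (Linf_norm \<omega>x + Linf_norm \<omega>y) * Linf_norm \<phi> * L1_norm \<rho>"

end

theory Submission
  imports Defs
begin

text \<open>
  On one cell \<open>Q\<close> let \<open>m\<close> be the mean of \<open>\<rho>\<close>. Since \<open>\<rho> - m\<close> has integral 0 over \<open>Q\<close>, the test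
  function may be replaced by \<open>\<phi> - \<phi>(z\<^sub>0)\<close>, with \<open>z\<^sub>0\<close> a corner of \<open>Q\<close>, in the integral of
  \<open>(m - \<rho>) \<phi>\<close>. Both factors are then bounded by the mesh size times the norms of the derivatives;
  the area of the cell contributes the mesh size squared, and the sum over the \<open>N\<^sup>2\<close> cells
  is of order \<open>N\<^sup>-\<^sup>2\<close> (\<open>mean_replacement_le\<close>, \<open>cell_error_le\<close>). For the product, with \<open>W\<close> the mean
  of \<open>\<omega>\<close>, one splits \<open>m W - \<rho> \<omega> = W (m - \<rho>) + \<rho> (W - \<omega>)\<close>. The first term is the previous one,
  multiplied by a number bounded by the norm of \<open>\<omega>\<close>; the second is of the order of the mesh size
  and integrates against \<open>\<bar>\<rho>\<bar>\<close> (\<open>rho_omega_hat_error\<close>).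

  What makes this work for weak derivatives is that a locally integrable \<open>f\<close> with essentially bounded
  weak derivatives is Lipschitz off a null set (\<open>weak_derivatives_bounded_imp_lipschitz\<close>). The proof
  avoids mollification. Let \<open>R\<close> be a rectangle and \<open>R'\<close> its translate by \<open>t\<close> in a coordinate
  direction. The difference of their indicators is a pointwise limit of derivatives, in that
  direction, of test functions \<open>\<alpha>(x) \<beta>(y)\<close> whose \<open>L\<^sup>1\<close> norms are controlled by \<open>t\<close>
  (\<open>bump_transport\<close>). Inserting them in the definition of the weak derivative bounds the difference of
  the integrals of \<open>f\<close> over \<open>R\<close> and \<open>R'\<close> (\<open>rectangle_shift_x\<close>, \<open>rectangle_shift_y\<close>). For squares
  that shrink to a point, Lebesgue's differentiation theorem turns the bound for averages into one
  for values.
\<close>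

section \<open>Smooth bumps on the line\<close>

text \<open>Continuous differentiability of order \<open>k\<close> in one variable, with the derivative given
  existentially. It shares its recursion with \<^const>\<open>Ck\<close>, so that products
  \<open>\<alpha>(x) \<beta>(y)\<close> are handled by a plain induction on \<open>k\<close>.\<close>

primrec C1d :: "nat \<Rightarrow> (real \<Rightarrow> real) \<Rightarrow> bool" where
  "C1d 0 f \<longleftrightarrow> continuous_on UNIV f"
| "C1d (Suc k) f \<longleftrightarrow> (\<exists>f'. (\<forall>x. (f has_real_derivative f' x) (at x)) \<and> C1d k f')"

lemma C1d_continuous: "C1d k f \<Longrightarrow> continuous_on UNIV f"
  by (cases k) (auto intro: DERIV_continuous_on has_field_derivative_at_within)

lemma C1d_SucD: "C1d (Suc k) f \<Longrightarrow> C1d k f"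
proof (induction k arbitrary: f)
  case 0
  then show ?case using C1d_continuous[of "Suc 0" f] by simp
next
  case (Suc k)
  then obtain f' where "\<forall>x. (f has_real_derivative f' x) (at x)" "C1d (Suc k) f'"
    by (metis C1d.simps(2))
  with Suc.IH show ?case by auto
qed

lemma C1d_add: "C1d k f \<Longrightarrow> C1d k g \<Longrightarrow> C1d k (\<lambda>x. f x + g x)"
proof (induction k arbitrary: f g)
  case 0
  then show ?case by (auto intro: continuous_intros)
next
  case (Suc k)
  then obtain f' g' where "\<forall>x. (f has_real_derivative f' x) (at x)" "C1d k f'"
      "\<forall>x. (g has_real_derivative g' x) (at x)" "C1d k g'"
    by auto
  with Suc.IH show ?case
    by (auto intro!: exI[of _ "\<lambda>x. f' x + g' x"] DERIV_add)
qed

lemma C1d_mult: "C1d k f \<Longrightarrow> C1d k g \<Longrightarrow> C1d k (\<lambda>x. f x * g x)"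
proof (induction k arbitrary: f g)
  case 0
  then show ?case by (auto intro: continuous_intros)
next
  case (Suc k)
  then obtain f' g' where *: "\<forall>x. (f has_real_derivative f' x) (at x)" "C1d k f'"
      "\<forall>x. (g has_real_derivative g' x) (at x)" "C1d k g'"
    by auto
  have "C1d k f" "C1d k g" using Suc.prems C1d_SucD by auto
  with * have "C1d k (\<lambda>x. f' x * g x + g' x * f x)"
    by (intro C1d_add Suc.IH)
  with * show ?case
    by (auto intro!: exI[of _ "\<lambda>x. f' x * g x + g' x * f x"] DERIV_mult)
qed

lemma C1d_const: "C1d k (\<lambda>x. c)"
  by (induction k arbitrary: c) (auto intro!: exI[of _ "\<lambda>x. 0"])

lemma C1d_affine: "C1d k f \<Longrightarrow> C1d k (\<lambda>x. f (c * x + d))"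
proof (induction k arbitrary: f)
  case 0
  then show ?case
    by (auto intro!: continuous_intros continuous_on_compose2[of UNIV f])
next
  case (Suc k)
  then obtain f' where *: "\<And>x. (f has_real_derivative f' x) (at x)" "C1d k f'"
    by auto
  have "((\<lambda>x. f (c * x + d)) has_real_derivative f' (c * x + d) * c) (at x)" for x
    by (rule DERIV_chain2[OF *(1)]) (auto intro!: derivative_eq_intros)
  moreover have "C1d k (\<lambda>x. f' (c * x + d) * c)"
    by (intro C1d_mult C1d_const Suc.IH *)
  ultimately show ?case unfolding C1d.simps
    by (intro exI[of _ "\<lambda>x. f' (c * x + d) * c"]) blast
qed

text \<open>The polynomial factor makes this family closed under differentiation: the derivative belongs to
  the polynomial \<open>X\<^sup>2 (p - p')\<close>. Hence all members are smooth, including the classical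
  \<open>exp (-1/x)\<close>, which is the case \<open>p = 1\<close>.\<close>

definition flat :: "real poly \<Rightarrow> real \<Rightarrow> real" where
  "flat p x = (if x > 0 then poly p (1/x) * exp (-1/x) else 0)"

lemma poly_exp_at_top: "((\<lambda>u. poly p u * exp (- u)) \<longlongrightarrow> 0) (at_top :: real filter)"
proof -
  have "((\<lambda>u. \<Sum>i\<le>degree p. coeff p i * (u ^ i / exp u)) \<longlongrightarrow> (\<Sum>i\<le>degree p. coeff p i * 0))
      (at_top :: real filter)"
    by (intro tendsto_sum tendsto_mult tendsto_const tendsto_power_div_exp_0)
  then show ?thesis
    by (simp add: poly_altdef sum_distrib_right sum_divide_distrib exp_minus field_simps)
qed

lemma flat_at_right_0: "(flat p \<longlongrightarrow> 0) (at_right 0)"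
proof -
  \<comment> \<open>Substitute \<open>u = 1/x\<close>, which tends to infinity as \<open>x\<close> decreases to 0.\<close>
  have "((\<lambda>x. poly p (inverse x) * exp (- inverse x)) \<longlongrightarrow> 0) (at_right 0)"
    using filterlim_compose[OF poly_exp_at_top filterlim_inverse_at_top_right] .
  moreover have "\<forall>\<^sub>F x in at_right 0. poly p (inverse x) * exp (- inverse x) = flat p x"
    by (auto simp: eventually_at_filter flat_def divide_simps)
  ultimately show ?thesis by (rule Lim_transform_eventually)
qed

lemma DERIV_flat: "(flat p has_real_derivative flat ([:0, 0, 1:] * (p - pderiv p)) x) (at x)"
proof -
  consider "x > 0" | "x < 0" | "x = 0" by linarith
  then show ?thesis
  proof cases
    case 1
    have "((\<lambda>x. poly p (1/x) * exp (-1/x)) has_real_derivative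
        poly ([:0, 0, 1:] * (p - pderiv p)) (1/x) * exp (-1/x)) (at x)"
      using 1 
      apply (auto intro!: derivative_eq_intros DERIV_chain2[OF poly_DERIV])
      apply (simp add: field_simps)
      done
    then have "(flat p has_real_derivative
        poly ([:0, 0, 1:] * (p - pderiv p)) (1/x) * exp (-1/x)) (at x)"
      by (rule has_field_derivative_transform_within_open[of _ _ _ "{0<..}"]) (use 1 in \<open>auto simp: flat_def\<close>)
    then show ?thesis using 1 by (simp add: flat_def)
  next
    case 2
    have "((\<lambda>x. 0) has_real_derivative 0) (at x)" by simp
    then have "(flat p has_real_derivative 0) (at x)"
      by (rule has_field_derivative_transform_within_open[of _ _ _ "{..<0}"]) (use 2 in \<open>auto simp: flat_def\<close>)
    then show ?thesis using 2 by (simp add: flat_def)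
  next
    case 3
    \<comment> \<open>The difference quotient at 0 is again a flat function, with \<open>p\<close> multiplied by the variable.\<close>
    have "((\<lambda>h. flat p h / h) \<longlongrightarrow> 0) (at_right 0)"
      by (rule Lim_transform_eventually[OF flat_at_right_0[of "pCons 0 p"]])
        (auto simp: eventually_at_filter flat_def)
    moreover have "((\<lambda>h. flat p h / h) \<longlongrightarrow> 0) (at_left 0)"
      by (rule Lim_transform_eventually[OF tendsto_const]) (auto simp: eventually_at_filter flat_def)
    ultimately have "((\<lambda>h. flat p h / h) \<longlongrightarrow> 0) (at 0)"
      using filterlim_split_at by blast
    then show ?thesis using 3 by (simp add: DERIV_def flat_def)
  qed
qed

lemma C1d_flat: "C1d k (flat p)"
proof (induction k arbitrary: p)
  case 0
  show ?case unfolding C1d.simps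
    by (rule DERIV_continuous_on[OF has_field_derivative_at_within[OF DERIV_flat]])
next
  case (Suc k)
  show ?case unfolding C1d.simps
    by (rule exI[of _ "flat ([:0, 0, 1:] * (p - pderiv p))"]) (intro conjI allI DERIV_flat Suc.IH)
qed

text \<open>The index \<open>n\<close> only rescales the argument of \<open>exp (-1/x)\<close>: since
  \<open>exp (-1/(n x))\<close> tends to 1 for every \<open>x > 0\<close>, these bumps increase to the indicator
  of the open interval \<open>(a, b)\<close>, and no normalisation is needed.\<close>

definition bump :: "nat \<Rightarrow> real \<Rightarrow> real \<Rightarrow> real \<Rightarrow> real" where
  "bump n a b x = flat 1 (real (Suc n) * (x - a)) * flat 1 (real (Suc n) * (b - x))"

lemma C1d_bump: "C1d k (bump n a b)"
proof -
  define c where "c = real (Suc n)"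
  have "c * (x - a) = c * x + - c * a" "c * (b - x) = - c * x + c * b" for x
    by (simp_all add: algebra_simps)
  then have "bump n a b = (\<lambda>x. flat 1 (c * x + - c * a) * flat 1 (- c * x + c * b))"
    unfolding fun_eq_iff bump_def c_def[symmetric] by presburger
  then show ?thesis
    by (simp only:) (intro C1d_mult C1d_affine C1d_flat)
qed

lemma flat_1_bounds: "0 \<le> flat 1 x" "flat 1 x \<le> 1"
  by (simp_all add: flat_def)

lemma bump_bounds: "0 \<le> bump n a b x" "bump n a b x \<le> 1"
  unfolding bump_def by (intro mult_nonneg_nonneg mult_le_one flat_1_bounds)+

lemma flat_nonpos: "x \<le> 0 \<Longrightarrow> flat p x = 0"
  by (simp add: flat_def)

lemma bump_eq_0:
  assumes "x \<notin> {a<..<b}"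
  shows "bump n a b x = 0"
proof -
  have "real (Suc n) * (x - a) \<le> 0 \<or> real (Suc n) * (b - x) \<le> 0"
    using assms by (simp only: mult_le_0_iff greaterThanLessThan_iff) linarith
  then show ?thesis by (auto simp only: bump_def flat_nonpos mult_zero_left mult_zero_right)
qed

lemma flat_1_scaled_tendsto: "x > 0 \<Longrightarrow> (\<lambda>n. flat 1 (real (Suc n) * x)) \<longlonglongrightarrow> 1"
proof -
  assume x: "x > 0"
  have "(\<lambda>n. exp (- (inverse (real (Suc n)) * inverse x))) \<longlonglongrightarrow> exp (- (0 * inverse x))"
    by (intro tendsto_intros LIMSEQ_inverse_real_of_nat)
  moreover have "exp (- (inverse (real (Suc n)) * inverse x)) = flat 1 (real (Suc n) * x)" for n
    using x by (auto simp: flat_def zero_less_mult_iff divide_simps)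
  ultimately show ?thesis by (simp del: of_nat_Suc)
qed

lemma bump_tendsto: "(\<lambda>n. bump n a b x) \<longlonglongrightarrow> indicator {a<..<b} x"
proof (cases "x \<in> {a<..<b}")
  case True
  then have "(\<lambda>n. bump n a b x) \<longlonglongrightarrow> 1 * 1"
    unfolding bump_def by (intro tendsto_mult flat_1_scaled_tendsto) auto
  with True show ?thesis by simp
qed (simp add: bump_eq_0)

text \<open>The difference of a bump and its translate by \<open>t\<close> is the derivative of a smooth function
  \<open>\<alpha>\<close> with compact support. The bounds \<open>0 \<le> \<alpha> \<le> b - a\<close> on an interval of length
  \<open>b - a + t\<close> are crude, but for intervals that shrink to a point they still give the optimal
  factor \<open>t\<close>.\<close>

lemma bump_transport:
  assumes "a \<le> b" "0 \<le> t"
  obtains \<alpha> where "\<And>k. C1d k \<alpha>"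
    "\<And>x. (\<alpha> has_real_derivative bump n a b x - bump n (a + t) (b + t) x) (at x)"
    "\<And>x. 0 \<le> \<alpha> x" "\<And>x. \<alpha> x \<le> b - a" "\<And>x. x \<notin> {a..b + t} \<Longrightarrow> \<alpha> x = 0"
proof -
  let ?b = "bump n a b"
  have "isCont ?b x" for x
    using C1d_continuous[OF C1d_bump] continuous_on_eq_continuous_at by blast
  then obtain B where "\<forall>x::real. -\<infinity> < ereal x \<longrightarrow> ereal x < \<infinity> \<longrightarrow> (B has_vector_derivative ?b x) (at x)"
    using einterval_antiderivative[of "-\<infinity>" "\<infinity>" ?b] by auto
  then have B: "(B has_real_derivative ?b x) (at x)" for x
    by (simp add: has_real_derivative_iff_has_vector_derivative)
  have shift: "bump n (a + t) (b + t) x = ?b (x - t)" for x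
    by (simp add: bump_def algebra_simps)
  \<comment> \<open>Both bumps have the same total mass, so this antiderivative of their difference has compact support.\<close>
  define \<alpha> where "\<alpha> x = B x - B (x - t)" for x
  have D: "(\<alpha> has_real_derivative ?b x - bump n (a + t) (b + t) x) (at x)" for x
  proof -
    have "((\<lambda>x. x - t) has_real_derivative 1) (at x)"
      by (auto intro!: derivative_eq_intros)
    from DERIV_chain2[where g = "\<lambda>x. x - t", OF B this]
    show ?thesis unfolding \<alpha>_def shift using DERIV_diff[OF B] by simp
  qed
  have S: "C1d k \<alpha>" for k
  proof (cases k)
    case 0
    show ?thesis unfolding 0 C1d.simps
      by (rule DERIV_continuous_on[OF has_field_derivative_at_within[OF D]])
  next
    case (Suc j)
    have "C1d j (\<lambda>x. ?b x + (-1) * bump n (a + t) (b + t) x)"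
      by (intro C1d_add C1d_mult C1d_const C1d_bump)
    then have "C1d j (\<lambda>x. ?b x - bump n (a + t) (b + t) x)" by simp
    then show ?thesis unfolding Suc C1d.simps using D
      by (intro exI[of _ "\<lambda>x. ?b x - bump n (a + t) (b + t) x"]) blast
  qed
  have mono: "B x \<le> B y" if "x \<le> y" for x y
    by (rule DERIV_nonneg_imp_nondecreasing[OF that]) (rule exI, rule conjI, rule B, rule bump_bounds)
  have lip: "B y - B x \<le> y - x" if "x \<le> y" for x y
  proof -
    have "((\<lambda>x. x - B x) has_real_derivative 1 - ?b x) (at x)" "0 \<le> 1 - ?b x" for x
      using bump_bounds(2)[of n a b x] by (auto intro: DERIV_diff B)
    then have "x - B x \<le> y - B y"
      by (intro DERIV_nonneg_imp_nondecreasing[OF that]) (rule exI, rule conjI)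
    then show ?thesis by simp
  qed
  \<comment> \<open>Outside \<open>(a, b)\<close> the bump vanishes, so its antiderivative is constant there.\<close>
  have left: "B x = B a" if "x \<le> a" for x
  proof (rule antisym[OF mono[OF that]])
    show "B a \<le> B x"
    proof (rule DERIV_nonpos_imp_nonincreasing[OF that])
      fix z assume "z \<le> a"
      then show "\<exists>d. (B has_real_derivative d) (at z) \<and> d \<le> 0"
        by (intro exI[of _ "?b z"] conjI B) (simp add: bump_eq_0)
    qed
  qed
  have right: "B x = B b" if "b \<le> x" for x
  proof (rule antisym)
    show "B x \<le> B b"
    proof (rule DERIV_nonpos_imp_nonincreasing[OF that])
      fix z assume "b \<le> z"
      then show "\<exists>d. (B has_real_derivative d) (at z) \<and> d \<le> 0"
        by (intro exI[of _ "?b z"] conjI B) (simp add: bump_eq_0)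
    qed
  qed (rule mono[OF that])
  have bnds: "B a \<le> B x" "B x \<le> B b" for x
    using left[of x] right[of x] mono[of a x] mono[of x b] mono[of a b] assms by linarith+
  show thesis
  proof
    show "0 \<le> \<alpha> x" for x using mono[of "x - t" x] assms by (simp add: \<alpha>_def)
    show "\<alpha> x \<le> b - a" for x
      using bnds[of x] bnds[of "x - t"] lip[of a b] assms by (simp add: \<alpha>_def)
    show "\<alpha> x = 0" if "x \<notin> {a..b + t}" for x
      using that left[of x] left[of "x - t"] right[of x] right[of "x - t"] assms
      by (auto simp: \<alpha>_def)
  qed (rule S, rule D)
qed

section \<open>Test functions in product form\<close>

lemma Ck_tensor: "C1d k \<alpha> \<Longrightarrow> C1d k \<beta> \<Longrightarrow> Ck k (\<lambda>(x, y). \<alpha> x * \<beta> y)"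
proof (induction k arbitrary: \<alpha> \<beta>)
  case 0
  then show ?case
    by (auto simp: case_prod_beta intro!: continuous_intros continuous_on_compose2[of UNIV \<alpha>] continuous_on_compose2[of UNIV \<beta>])
next
  case (Suc k)
  then obtain \<alpha>' \<beta>' where d: "\<And>x. (\<alpha> has_real_derivative \<alpha>' x) (at x)" "C1d k \<alpha>'"
      "\<And>x. (\<beta> has_real_derivative \<beta>' x) (at x)" "C1d k \<beta>'"
    by auto
  have dx: "((\<lambda>s. \<alpha> s * \<beta> y) has_real_derivative \<alpha>' x * \<beta> y) (at x)" for x y
    by (auto intro!: derivative_eq_intros d)
  have dy: "((\<lambda>s. \<alpha> x * \<beta> s) has_real_derivative \<alpha> x * \<beta>' y) (at y)" for x y
    by (auto intro!: derivative_eq_intros d)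
  have px: "pd_x (\<lambda>(x, y). \<alpha> x * \<beta> y) = (\<lambda>(x, y). \<alpha>' x * \<beta> y)"
    using DERIV_imp_deriv[OF dx] by (auto simp: pd_x_def fun_eq_iff)
  have py: "pd_y (\<lambda>(x, y). \<alpha> x * \<beta> y) = (\<lambda>(x, y). \<alpha> x * \<beta>' y)"
    using DERIV_imp_deriv[OF dy] by (auto simp: pd_y_def fun_eq_iff)
  have "continuous_on UNIV \<alpha>" "continuous_on UNIV \<beta>"
    using Suc.prems C1d_continuous by blast+
  then have "continuous_on UNIV (\<lambda>(x, y). \<alpha> x * \<beta> y)"
    by (auto simp: case_prod_beta intro!: continuous_intros continuous_on_compose2[of UNIV \<alpha>] continuous_on_compose2[of UNIV \<beta>])
  moreover have "C1d k \<alpha>" "C1d k \<beta>" using Suc.prems C1d_SucD by auto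
  moreover have "(\<lambda>s. (case (s, y) of (x, y) \<Rightarrow> \<alpha> x * \<beta> y)) field_differentiable at x"
    "(\<lambda>t. (case (x, t) of (x, y) \<Rightarrow> \<alpha> x * \<beta> y)) field_differentiable at y" for x y
    using dx dy unfolding field_differentiable_def split_conv by blast+
  ultimately show ?case
    unfolding Ck.simps px py by (intro conjI allI Suc.IH d)
qed

lemma Cc_smooth_tensor:
  assumes "\<And>k. C1d k \<alpha>" "\<And>k. C1d k \<beta>"
    and "\<And>x. x \<notin> {a..b} \<Longrightarrow> \<alpha> x = 0" "\<And>y. y \<notin> {c..d} \<Longrightarrow> \<beta> y = 0"
  shows "(\<lambda>(x, y). \<alpha> x * \<beta> y) \<in> Cc_smooth"
proof -
  let ?S = "{z. (case z of (x, y) \<Rightarrow> \<alpha> x * \<beta> y) \<noteq> 0}"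
  have "?S \<subseteq> {a..b} \<times> {c..d}"
    using assms(3,4) by auto blast+
  moreover have "bounded ({a..b} \<times> {c..d})"
    by (intro bounded_Times bounded_closed_interval)
  ultimately have "compact (closure ?S)"
    by (simp add: bounded_subset)
  with assms(1,2) show ?thesis by (auto simp: Cc_smooth_def intro!: Ck_tensor)
qed

section \<open>Weak derivatives control differences of rectangle integrals\<close>

text \<open>If \<open>f\<close> is not integrable, then the left-hand side is 0 by convention.\<close>

lemma abs_integral_le_AE:
  fixes f w :: "'a \<Rightarrow> real"
  assumes "integrable M w" "AE x in M. \<bar>f x\<bar> \<le> w x"
  shows "\<bar>LINT x|M. f x\<bar> \<le> (LINT x|M. w x)"
proof -
  have 0: "AE x in M. 0 \<le> w x" using assms(2) by eventually_elim linarith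
  have "AE x in M. f x \<le> w x" using assms(2) by eventually_elim linarith
  from integral_mono_AE'[OF assms(1) this 0]
  have "(LINT x|M. f x) \<le> (LINT x|M. w x)" .
  moreover have "AE x in M. - f x \<le> w x" using assms(2) by eventually_elim linarith
  from integral_mono_AE'[OF assms(1) this 0]
  have "- (LINT x|M. f x) \<le> (LINT x|M. w x)" by simp
  ultimately show ?thesis by linarith
qed

lemma locally_integrable_measurable:
  assumes "locally_integrable f"
  shows "f \<in> borel_measurable lebesgue"
proof (rule borel_measurable_LIMSEQ_real)
  fix n :: nat
  have "set_integrable lebesgue (cball 0 (real n)) f"
    using assms compact_cball unfolding locally_integrable_def by blast
  then show "(\<lambda>z. indicator (cball 0 (real n)) z * f z) \<in> borel_measurable lebesgue"
    by (simp add: set_integrable_def borel_measurable_integrable)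
next
  fix z :: "real \<times> real"
  obtain m :: nat where "norm z \<le> real m" using real_arch_simple by blast
  then have "\<forall>\<^sub>F n in sequentially. f z = indicator (cball 0 (real n)) z * f z"
    by (auto simp: eventually_sequentially intro!: exI[of _ m])
  then show "(\<lambda>n. indicator (cball 0 (real n)) z * f z) \<longlonglongrightarrow> f z"
    by (rule Lim_transform_eventually[OF tendsto_const])
qed

lemma rectangle_eq_cbox:
  fixes a b c d :: real
  shows "{a..b} \<times> {c..d} = cbox (a, c) (b, d)" "{a<..<b} \<times> {c<..<d} = box (a, c) (b, d)"
  by (auto simp: cbox_Pair_eq box_def Basis_prod_def)

lemma lmeasurable_rectangle: 
  fixes a b c d :: real
  shows "{a..b} \<times> {c..d} \<in> lmeasurable" 
  unfolding rectangle_eq_cbox by simp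

lemma measure_rectangle:
  fixes a b c d :: real
  assumes "a \<le> b" "c \<le> d"
  shows "measure lebesgue ({a..b} \<times> {c..d}) = (b - a) * (d - c)"
  unfolding rectangle_eq_cbox using assms by (simp add: content_Pair)

lemma locally_integrable_times_bounded:
  assumes f: "locally_integrable f" and m: "\<psi> \<in> borel_measurable lebesgue"
    and b: "\<And>z. \<bar>\<psi> z\<bar> \<le> C" and K: "compact K" "\<And>z. z \<notin> K \<Longrightarrow> \<psi> z = 0"
  shows "integrable lebesgue (\<lambda>z. f z * \<psi> z)"
proof (rule Bochner_Integration.integrable_bound)
  show "integrable lebesgue (\<lambda>z. C * (indicator K z *\<^sub>R f z))"
    using f K(1) unfolding locally_integrable_def set_integrable_def by simp
  show "(\<lambda>z. f z * \<psi> z) \<in> borel_measurable lebesgue"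
    using locally_integrable_measurable[OF f] m by (rule borel_measurable_times)
  have "norm (f z * \<psi> z) \<le> norm (C * (indicator K z *\<^sub>R f z))" for z
  proof (cases "z \<in> K")
    case True
    moreover have "\<bar>\<psi> z\<bar> \<le> \<bar>C\<bar>" using b[of z] by linarith
    ultimately show ?thesis by (simp add: abs_mult mult.commute mult_right_mono)
  qed (simp add: K)
  then show "AE z in lebesgue. norm (f z * \<psi> z) \<le> norm (C * (indicator K z *\<^sub>R f z))" by simp
qed

lemma continuous_borel_lebesgue: "continuous_on UNIV (f :: real \<times> real \<Rightarrow> real)
    \<Longrightarrow> f \<in> borel_measurable lebesgue"
  by (intro measurable_completion) (simp add: borel_measurable_continuous_onI)

lemma continuous_bump_tensor: "continuous_on UNIV (\<lambda>z. bump n a b (fst z) * bump n c d (snd z))"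
  by (intro continuous_intros continuous_on_compose2[OF C1d_continuous[OF C1d_bump[of 0]]]) auto

lemma bump_tensor_le_indicator:
  "\<bar>bump n a b (fst z) * bump n c d (snd z)\<bar> \<le> indicator ({a<..<b} \<times> {c<..<d}) z"
proof (cases "z \<in> {a<..<b} \<times> {c<..<d}")
  case True
  then show ?thesis
    using mult_le_one[OF bump_bounds(2)[of n a b "fst z"] bump_bounds[of n c d "snd z"]]
      bump_bounds(1)[of n a b "fst z"] bump_bounds(1)[of n c d "snd z"] by simp
next
  case False
  then have "fst z \<notin> {a<..<b} \<or> snd z \<notin> {c<..<d}" by (auto simp: mem_Times_iff)
  with False show ?thesis using bump_eq_0 by auto
qed

lemma integrable_bump_tensor:
  assumes "locally_integrable f"
  shows "integrable lebesgue (\<lambda>z. f z * (bump n a b (fst z) * bump n c d (snd z)))"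
proof (rule locally_integrable_times_bounded[OF assms continuous_borel_lebesgue[OF continuous_bump_tensor], where C = 1 and K = "cbox (a, c) (b, d)"])
  fix z
  note * = bump_tensor_le_indicator[of n a b z c d]
  show "\<bar>bump n a b (fst z) * bump n c d (snd z)\<bar> \<le> 1"
    by (rule order_trans[OF *]) (simp add: indicator_def)
  assume "z \<notin> cbox (a, c) (b, d)"
  then have "z \<notin> {a<..<b} \<times> {c<..<d}"
    using box_subset_cbox by (metis rectangle_eq_cbox(2) subsetD)
  with * show "bump n a b (fst z) * bump n c d (snd z) = 0" by simp
qed simp

text \<open>Dominated convergence, since the bumps stay below the indicator of the closed rectangle.\<close>

lemma integral_bump_tensor_tendsto:
  assumes "locally_integrable f"
  shows "(\<lambda>n. LINT z|lebesgue. f z * (bump n a b (fst z) * bump n c d (snd z)))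
    \<longlonglongrightarrow> (LINT z:{a<..<b} \<times> {c<..<d}|lebesgue. f z)"
  unfolding set_lebesgue_integral_def
proof (rule integral_dominated_convergence[where w
    = "\<lambda>z. \<bar>indicator (cbox (a, c) (b, d)) z *\<^sub>R f z\<bar>"])
  note m = locally_integrable_measurable[OF assms]
  show "(\<lambda>z. indicator ({a<..<b} \<times> {c<..<d}) z *\<^sub>R f z) \<in> borel_measurable lebesgue"
    unfolding rectangle_eq_cbox using m
    by (intro borel_measurable_scaleR borel_measurable_indicator) (auto intro: sets_completionI_sets)
  show "(\<lambda>z. f z * (bump n a b (fst z) * bump n c d (snd z))) \<in> borel_measurable lebesgue" for n
    using integrable_bump_tensor[OF assms] by (rule borel_measurable_integrable)
  show "integrable lebesgue (\<lambda>z. \<bar>indicator (cbox (a, c) (b, d)) z *\<^sub>R f z\<bar>)"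
    using assms unfolding locally_integrable_def set_integrable_def
    by (intro integrable_abs) (use compact_cbox in blast)
  have "(\<lambda>n. f z * (bump n a b (fst z) * bump n c d (snd z)))
      \<longlonglongrightarrow> f z * (indicator {a<..<b} (fst z) * indicator {c<..<d} (snd z))" for z
    by (intro tendsto_intros bump_tendsto)
  then show "AE z in lebesgue. (\<lambda>n. f z * (bump n a b (fst z) * bump n c d (snd z)))
      \<longlonglongrightarrow> indicator ({a<..<b} \<times> {c<..<d}) z *\<^sub>R f z"
    by (simp add: indicator_times mult.commute)
  have "norm (f z * (bump n a b (fst z) * bump n c d (snd z)))
      \<le> \<bar>indicator (cbox (a, c) (b, d)) z *\<^sub>R f z\<bar>" for z n
  proof -
    have "indicator ({a<..<b} \<times> {c<..<d}) z \<le> (indicator (cbox (a, c) (b, d)) z :: real)"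
      unfolding rectangle_eq_cbox using box_subset_cbox[of "(a, c)" "(b, d)"]
      by (auto simp: indicator_def)
    with bump_tensor_le_indicator[of n a b z c d]
    have "\<bar>bump n a b (fst z) * bump n c d (snd z)\<bar> \<le> indicator (cbox (a, c) (b, d)) z" by linarith
    then have "\<bar>f z\<bar> * \<bar>bump n a b (fst z) * bump n c d (snd z)\<bar>
        \<le> \<bar>f z\<bar> * indicator (cbox (a, c) (b, d)) z"
      by (intro mult_left_mono) auto
    then show ?thesis by (simp add: abs_mult mult.commute)
  qed
  then show "AE z in lebesgue. norm (f z * (bump n a b (fst z) * bump n c d (snd z)))
      \<le> \<bar>indicator (cbox (a, c) (b, d)) z *\<^sub>R f z\<bar>" for n
    by simp
qed

text \<open>Estimates against products of bumps pass to the limit and become estimates for the integrals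
  of \<open>f\<close> over rectangles.\<close>

lemma rectangle_difference_le:
  assumes f: "locally_integrable f"
    and le: "\<And>n. \<bar>LINT z|lebesgue. f z * (bump n a b (fst z) * bump n c d (snd z)
        - bump n a' b' (fst z) * bump n c' d' (snd z))\<bar> \<le> K"
  shows "\<bar>(LINT z:{a<..<b} \<times> {c<..<d}|lebesgue. f z) -
      (LINT z:{a'<..<b'} \<times> {c'<..<d'}|lebesgue. f z)\<bar> \<le> K"
proof (rule tendsto_upperbound)
  show "(\<lambda>n. \<bar>(LINT z|lebesgue. f z * (bump n a b (fst z) * bump n c d (snd z)))
      - (LINT z|lebesgue. f z * (bump n a' b' (fst z) * bump n c' d' (snd z)))\<bar>)
    \<longlonglongrightarrow> \<bar>(LINT z:{a<..<b} \<times> {c<..<d}|lebesgue. f z) - (LINT z:{a'<..<b'} \<times> {c'<..<d'}|lebesgue. f z)\<bar>"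
    by (intro tendsto_rabs tendsto_diff integral_bump_tensor_tendsto f)
  show "\<forall>\<^sub>F n in sequentially. \<bar>(LINT z|lebesgue. f z * (bump n a b (fst z) * bump n c d (snd z)))
      - (LINT z|lebesgue. f z * (bump n a' b' (fst z) * bump n c' d' (snd z)))\<bar> \<le> K"
    using le by (simp add: right_diff_distrib integrable_bump_tensor[OF f])
qed simp

lemma abs_integral_times_le:
  fixes K :: "(real \<times> real) set"
  assumes g: "AE z in lebesgue. \<bar>g z\<bar> \<le> M" and K: "K \<in> lmeasurable"
    and \<psi>: "\<And>z. \<bar>\<psi> z\<bar> \<le> C * indicator K z"
  shows "\<bar>LINT z|lebesgue. g z * \<psi> z\<bar> \<le> M * C * measure lebesgue K"
proof -
  have "integrable lebesgue (\<lambda>z. M * C * indicator K z)"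
    using K by (auto simp: fmeasurable_def intro!: integrable_mult_right integrable_real_indicator)
  moreover have "AE z in lebesgue. \<bar>g z * \<psi> z\<bar> \<le> M * C * indicator K z"
    using g
  proof eventually_elim
    case (elim z)
    have "\<bar>g z\<bar> * \<bar>\<psi> z\<bar> \<le> M * (C * indicator K z)"
      using elim \<psi>[of z] by (intro mult_mono) auto
    then show ?case by (simp add: abs_mult mult.assoc)
  qed
  ultimately have "\<bar>LINT z|lebesgue. g z * \<psi> z\<bar> \<le> (LINT z|lebesgue. M * C * indicator K z)"
    by (rule abs_integral_le_AE)
  then show ?thesis by simp
qed

text \<open>The test function \<open>\<alpha>(x) \<beta>(y)\<close> is used, where \<open>\<beta>\<close> is a bump on \<open>(c, d)\<close> and
  \<open>\<alpha>\<close> comes from \<open>bump_transport\<close>. Its \<open>x\<close>-derivative approximates the difference of the indicators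
  of the two rectangles, while its \<open>L\<^sup>1\<close> norm is at most the product on the right-hand side without \<open>M\<close>.\<close>

lemma rectangle_shift_x:
  assumes w: "weak_pd_x f g" and g: "AE z in lebesgue. \<bar>g z\<bar> \<le> M"
    and ab: "a \<le> b" "c \<le> d" "0 \<le> t"
  shows "\<bar>(LINT z:{a<..<b} \<times> {c<..<d}|lebesgue. f z) -
      (LINT z:{a+t<..<b+t} \<times> {c<..<d}|lebesgue. f z)\<bar>
    \<le> M * (b - a) * ((b + t - a) * (d - c))"
proof (rule rectangle_difference_le)
  show "locally_integrable f" using w by (simp add: weak_pd_x_def)
  fix n
  from ab obtain \<alpha> where \<alpha>: "\<And>k. C1d k \<alpha>"
    "\<And>x. (\<alpha> has_real_derivative bump n a b x - bump n (a + t) (b + t) x) (at x)"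
    "\<And>x. 0 \<le> \<alpha> x" "\<And>x. \<alpha> x \<le> b - a" "\<And>x. x \<notin> {a..b + t} \<Longrightarrow> \<alpha> x = 0"
    using bump_transport by metis
  let ?\<phi> = "\<lambda>(x, y). \<alpha> x * bump n c d y"
  have "?\<phi> \<in> Cc_smooth"
    by (rule Cc_smooth_tensor[OF \<alpha>(1) C1d_bump \<alpha>(5), where c = c and d = d])
      (auto intro: bump_eq_0)
  then have ibp: "(LINT z|lebesgue. f z * pd_x ?\<phi> z) = - (LINT z|lebesgue. g z * ?\<phi> z)"
    using w unfolding weak_pd_x_def by blast
  have "((\<lambda>s. \<alpha> s * bump n c d y) has_real_derivative
      (bump n a b x - bump n (a + t) (b + t) x) * bump n c d y) (at x)" for x y
    by (auto intro!: derivative_eq_intros \<alpha>)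
  then have pd: "pd_x ?\<phi> = (\<lambda>z. bump n a b (fst z) * bump n c d (snd z)
      - bump n (a + t) (b + t) (fst z) * bump n c d (snd z))"
    unfolding pd_x_def by (auto simp: DERIV_imp_deriv left_diff_distrib)
  have "(LINT z|lebesgue. f z * (bump n a b (fst z) * bump n c d (snd z)
      - bump n (a + t) (b + t) (fst z) * bump n c d (snd z)))
      = - (LINT z|lebesgue. g z * ?\<phi> z)"
    using ibp unfolding pd .
  moreover have "\<bar>LINT z|lebesgue. g z * ?\<phi> z\<bar> \<le> M * (b
      - a) * measure lebesgue ({a..b + t} \<times> {c..d})"
  proof (rule abs_integral_times_le[OF g lmeasurable_rectangle])
    show "\<bar>?\<phi> z\<bar> \<le> (b - a) * indicator ({a..b + t} \<times> {c..d}) z" for z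
    proof (cases "z \<in> {a..b + t} \<times> {c..d}")
      case True
      have "\<bar>\<alpha> (fst z)\<bar> * \<bar>bump n c d (snd z)\<bar> \<le> (b - a) * 1"
        using \<alpha>(3)[of "fst z"] \<alpha>(4)[of "fst z"] bump_bounds[of n c d "snd z"]
            by (intro mult_mono) auto
      then show ?thesis using True by (simp add: case_prod_beta abs_mult)
    next
      case False
      then have "fst z \<notin> {a..b + t} \<or> snd z \<notin> {c<..<d}" by (auto simp: mem_Times_iff)
      then show ?thesis using \<alpha>(5) bump_eq_0 False by (auto simp: case_prod_beta)
    qed
  qed
  ultimately show "\<bar>LINT z|lebesgue. f z * (bump n a b (fst z) * bump n c d (snd z)
      - bump n (a + t) (b + t) (fst z) * bump n c d (snd z))\<bar>
      \<le> M * (b - a) * ((b + t - a) * (d - c))"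
    using ab by (simp add: measure_rectangle)
qed

lemma rectangle_shift_y:
  assumes w: "weak_pd_y f g" and g: "AE z in lebesgue. \<bar>g z\<bar> \<le> M"
    and ab: "a \<le> b" "c \<le> d" "0 \<le> t"
  shows "\<bar>(LINT z:{a<..<b} \<times> {c<..<d}|lebesgue. f z) -
      (LINT z:{a<..<b} \<times> {c+t<..<d+t}|lebesgue. f z)\<bar>
    \<le> M * (d - c) * ((b - a) * (d + t - c))"
proof (rule rectangle_difference_le)
  show "locally_integrable f" using w by (simp add: weak_pd_y_def)
  fix n
  from ab obtain \<beta> where \<beta>: "\<And>k. C1d k \<beta>"
    "\<And>x. (\<beta> has_real_derivative bump n c d x - bump n (c + t) (d + t) x) (at x)"
    "\<And>x. 0 \<le> \<beta> x" "\<And>x. \<beta> x \<le> d - c" "\<And>x. x \<notin> {c..d + t} \<Longrightarrow> \<beta> x = 0"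
    using bump_transport by metis
  let ?\<phi> = "\<lambda>(x, y). bump n a b x * \<beta> y"
  have "?\<phi> \<in> Cc_smooth"
    by (rule Cc_smooth_tensor[OF C1d_bump \<beta>(1) _ \<beta>(5), where a = a and b = b])
      (auto intro: bump_eq_0)
  then have ibp: "(LINT z|lebesgue. f z * pd_y ?\<phi> z) = - (LINT z|lebesgue. g z * ?\<phi> z)"
    using w unfolding weak_pd_y_def by blast
  have "((\<lambda>s. bump n a b x * \<beta> s) has_real_derivative
      bump n a b x * (bump n c d y - bump n (c + t) (d + t) y)) (at y)" for x y
    by (auto intro!: derivative_eq_intros \<beta>)
  then have pd: "pd_y ?\<phi> = (\<lambda>z. bump n a b (fst z) * bump n c d (snd z)
      - bump n a b (fst z) * bump n (c + t) (d + t) (snd z))"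
    unfolding pd_y_def by (auto simp: DERIV_imp_deriv right_diff_distrib)
  have "(LINT z|lebesgue. f z * (bump n a b (fst z) * bump n c d (snd z)
      - bump n a b (fst z) * bump n (c + t) (d + t) (snd z)))
      = - (LINT z|lebesgue. g z * ?\<phi> z)"
    using ibp unfolding pd .
  moreover have "\<bar>LINT z|lebesgue. g z * ?\<phi> z\<bar> \<le> M * (d
      - c) * measure lebesgue ({a..b} \<times> {c..d + t})"
  proof (rule abs_integral_times_le[OF g lmeasurable_rectangle])
    show "\<bar>?\<phi> z\<bar> \<le> (d - c) * indicator ({a..b} \<times> {c..d + t}) z" for z
    proof (cases "z \<in> {a..b} \<times> {c..d + t}")
      case True
      have "\<bar>bump n a b (fst z)\<bar> * \<bar>\<beta> (snd z)\<bar> \<le> 1 * (d - c)"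
        using \<beta>(3)[of "snd z"] \<beta>(4)[of "snd z"] bump_bounds[of n a b "fst z"]
            by (intro mult_mono) auto
      then show ?thesis using True by (simp add: case_prod_beta abs_mult)
    next
      case False
      then have "fst z \<notin> {a<..<b} \<or> snd z \<notin> {c..d + t}" by (auto simp: mem_Times_iff)
      then show ?thesis using \<beta>(5) bump_eq_0 False by (auto simp: case_prod_beta)
    qed
  qed
  ultimately show "\<bar>LINT z|lebesgue. f z * (bump n a b (fst z) * bump n c d (snd z)
      - bump n a b (fst z) * bump n (c + t) (d + t) (snd z))\<bar>
      \<le> M * (d - c) * ((b - a) * (d + t - c))"
    using ab by (simp add: measure_rectangle)
qed

section \<open>Essential bounds and test functions\<close>

lemma AE_le_Linf_norm:
  assumes "f \<in> Linf"
  shows "AE z in lebesgue. \<bar>f z\<bar> \<le> Linf_norm f"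
  using esssup_AE[of "\<lambda>z. ereal \<bar>f z\<bar>" lebesgue]
proof eventually_elim
  case (elim z)
  with assms show ?case
    unfolding Linf_norm_def Linf_def by (cases "esssup lebesgue (\<lambda>z. ereal \<bar>f z\<bar>)") auto
qed

text \<open>A continuous function exceeds its essential supremum only on an open null set, that is, nowhere.
  Some bound \<open>C\<close> has to be known beforehand, because \<^const>\<open>Linf_norm\<close> is 0 when the
  essential supremum is infinite.\<close>

lemma continuous_bounded_le_Linf_norm:
  assumes c: "continuous_on UNIV f" and b: "\<And>z. \<bar>f z\<bar> \<le> C"
  shows "\<bar>f z\<bar> \<le> Linf_norm f"
proof (rule ccontr)
  have "(\<lambda>z. ereal \<bar>f z\<bar>) \<in> borel_measurable lebesgue"
    using continuous_borel_lebesgue[OF c] by simp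
  then have "esssup lebesgue (\<lambda>z. ereal \<bar>f z\<bar>) \<le> ereal C"
    using b by (intro esssup_I) auto
  then have "f \<in> Linf"
    using continuous_borel_lebesgue[OF c] by (auto simp: Linf_def)
  from AE_le_Linf_norm[OF this] have "{z. \<not> \<bar>f z\<bar> \<le> Linf_norm f} \<in> null_sets lebesgue"
    by (simp add: completion.AE_iff_null_sets)
  then have "negligible {z. Linf_norm f < \<bar>f z\<bar>}"
    by (simp add: negligible_iff_null_sets not_le)
  moreover have "open {z. Linf_norm f < \<bar>f z\<bar>}"
    using c by (intro open_Collect_less continuous_intros)
  moreover assume "\<not> \<bar>f z\<bar> \<le> Linf_norm f"
  then have "z \<in> {z. Linf_norm f < \<bar>f z\<bar>}" by simp
  ultimately show False
    using open_not_negligible by blast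
qed

lemma bounded_of_compact_support:
  fixes f :: "real \<times> real \<Rightarrow> real"
  assumes "continuous_on UNIV f" "compact K" "\<And>z. z \<notin> K \<Longrightarrow> f z = 0"
  obtains C where "\<And>z. \<bar>f z\<bar> \<le> C"
proof -
  have "bounded (f ` K)"
    using assms by (intro compact_imp_bounded compact_continuous_image) (auto intro: continuous_on_subset)
  then obtain C where "\<forall>z\<in>K. \<bar>f z\<bar> \<le> C" by (auto simp: bounded_iff)
  then have "\<bar>f z\<bar> \<le> max C 0" for z
    using assms(3)[of z] by (cases "z \<in> K") (auto simp: max_def)
  then show thesis by (rule that)
qed

lemma Cc_smooth_derivatives_and_bounds:
  assumes "\<phi> \<in> Cc_smooth"
  shows "continuous_on UNIV \<phi>"
    and "((\<lambda>s. \<phi> (s, y)) has_real_derivative pd_x \<phi> (x, y)) (at x)"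
    and "((\<lambda>t. \<phi> (x, t)) has_real_derivative pd_y \<phi> (x, y)) (at y)"
    and "\<bar>\<phi> z\<bar> \<le> Linf_norm \<phi>" "\<bar>pd_x \<phi> z\<bar> \<le> Linf_norm (pd_x \<phi>)" "\<bar>pd_y \<phi> z\<bar> \<le> Linf_norm (pd_y \<phi>)"
proof -
  define K where "K = closure {z. \<phi> z \<noteq> 0}"
  have K: "compact K" and "Ck (Suc 0) \<phi>"
    using assms unfolding Cc_smooth_def K_def by blast+
  then have c: "continuous_on UNIV \<phi>" "continuous_on UNIV (pd_x \<phi>)" "continuous_on UNIV (pd_y \<phi>)"
    and fd: "\<And>x y. (\<lambda>s. \<phi> (s, y)) field_differentiable at x" 
        "\<And>x y. (\<lambda>t. \<phi> (x, t)) field_differentiable at y"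
    unfolding Ck.simps by blast+
  have out: "\<phi> z = 0" if "z \<notin> K" for z
    using that closure_subset[of "{z. \<phi> z \<noteq> 0}"] unfolding K_def by auto
  have d: "((\<lambda>s. \<phi> (s, y)) has_real_derivative pd_x \<phi> (x, y)) (at x)"
    "((\<lambda>t. \<phi> (x, t)) has_real_derivative pd_y \<phi> (x, y)) (at y)" for x y
    using field_differentiable_derivI[OF fd(1)[of y x]] field_differentiable_derivI[OF fd(2)[of x y]]
    by (simp_all add: pd_x_def pd_y_def)
  have "open (- K)" using K compact_imp_closed by blast
  have "pd_x \<phi> z = 0" if "z \<notin> K" for z
  proof -
    obtain x y where z: "z = (x, y)" by (cases z)
    let ?U = "(\<lambda>s. (s, y)) -` (- K)"
    have "((\<lambda>s. \<phi> (s, y)) has_real_derivative 0) (at x)"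
    proof (rule has_field_derivative_transform_within_open[where f = "\<lambda>_. 0"])
      show "open ?U" by (rule open_vimage[OF \<open>open (- K)\<close>]) (intro continuous_intros)
    qed (use that out z in auto)
    with d(1)[of y x] show ?thesis unfolding z using DERIV_unique by blast
  qed
  then obtain Cx where Cx: "\<And>z. \<bar>pd_x \<phi> z\<bar> \<le> Cx"
    using bounded_of_compact_support[OF c(2) K] by blast
  have "pd_y \<phi> z = 0" if "z \<notin> K" for z
  proof -
    obtain x y where z: "z = (x, y)" by (cases z)
    let ?U = "(\<lambda>t. (x, t)) -` (- K)"
    have "((\<lambda>t. \<phi> (x, t)) has_real_derivative 0) (at y)"
    proof (rule has_field_derivative_transform_within_open[where f = "\<lambda>_. 0"])
      show "open ?U" by (rule open_vimage[OF \<open>open (- K)\<close>]) (intro continuous_intros)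
    qed (use that out z in auto)
    with d(2)[of x y] show ?thesis unfolding z using DERIV_unique by blast
  qed
  then obtain Cy where Cy: "\<And>z. \<bar>pd_y \<phi> z\<bar> \<le> Cy"
    using bounded_of_compact_support[OF c(3) K] by blast
  obtain C where C: "\<And>z. \<bar>\<phi> z\<bar> \<le> C"
    using bounded_of_compact_support[OF c(1) K out] by blast
  show "\<bar>\<phi> z\<bar> \<le> Linf_norm \<phi>" "\<bar>pd_x \<phi> z\<bar> \<le> Linf_norm (pd_x \<phi>)" "\<bar>pd_y \<phi> z\<bar> \<le> Linf_norm (pd_y \<phi>)"
    by (fact continuous_bounded_le_Linf_norm[OF c(1) C] continuous_bounded_le_Linf_norm[OF c(2) Cx]
        continuous_bounded_le_Linf_norm[OF c(3) Cy])+
  show "continuous_on UNIV \<phi>"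
    "((\<lambda>s. \<phi> (s, y)) has_real_derivative pd_x \<phi> (x, y)) (at x)"
    "((\<lambda>t. \<phi> (x, t)) has_real_derivative pd_y \<phi> (x, y)) (at y)"
    by (fact c(1) d)+
qed

lemma DERIV_bounded_imp_lipschitz:
  fixes f :: "real \<Rightarrow> real"
  assumes "\<And>x. (f has_real_derivative f' x) (at x)" "\<And>x. \<bar>f' x\<bar> \<le> M"
  shows "\<bar>f x - f y\<bar> \<le> M * \<bar>x - y\<bar>"
  using field_differentiable_bound[of UNIV f f' M x y] assms
  by (auto intro: has_field_derivative_at_within)

lemma Cc_smooth_lipschitz:
  assumes "\<phi> \<in> Cc_smooth"
  shows "\<bar>\<phi> (x, y) - \<phi> (x', y')\<bar> \<le> Linf_norm (pd_x \<phi>) * \<bar>x - x'\<bar> + Linf_norm (pd_y \<phi>) * \<bar>y - y'\<bar>"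
proof -
  have "\<bar>\<phi> (x, y) - \<phi> (x', y)\<bar> \<le> Linf_norm (pd_x \<phi>) * \<bar>x - x'\<bar>"
    by (rule DERIV_bounded_imp_lipschitz[of "\<lambda>s. \<phi> (s, y)" "\<lambda>s. pd_x \<phi> (s, y)"])
      (rule Cc_smooth_derivatives_and_bounds[OF assms])+
  moreover have "\<bar>\<phi> (x', y) - \<phi> (x', y')\<bar> \<le> Linf_norm (pd_y \<phi>) * \<bar>y - y'\<bar>"
    by (rule DERIV_bounded_imp_lipschitz[of "\<lambda>t. \<phi> (x', t)" "\<lambda>t. pd_y \<phi> (x', t)"])
      (rule Cc_smooth_derivatives_and_bounds[OF assms])+
  ultimately show ?thesis by linarith
qed

section \<open>Bounded weak derivatives imply Lipschitz continuity\<close>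

text \<open>Averages over squares of side \<open>h\<close> satisfy the Lipschitz estimate up to a term of order
  \<open>h\<close>.\<close>

lemma squares_close_x:
  assumes "weak_pd_x f g" "AE z in lebesgue. \<bar>g z\<bar> \<le> M" "0 < h"
  shows "\<bar>(LINT z:{x<..<x+h} \<times> {y<..<y+h}|lebesgue. f z) / h\<^sup>2 -
      (LINT z:{x'<..<x'+h} \<times> {y<..<y+h}|lebesgue. f z) / h\<^sup>2\<bar>
    \<le> M * (h + \<bar>x - x'\<bar>)"
proof -
  have *: "\<bar>(LINT z:{x<..<x+h} \<times> {y<..<y+h}|lebesgue. f z) -
      (LINT z:{x'<..<x'+h} \<times> {y<..<y+h}|lebesgue. f z)\<bar>
    \<le> M * (h + \<bar>x - x'\<bar>) * h\<^sup>2" if "x \<le> x'" for x x'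
    using rectangle_shift_x[OF assms(1,2), of x "x + h" y "y + h" "x' - x"] assms(3) that
    by (simp add: algebra_simps power2_eq_square)
  have "\<bar>(LINT z:{x<..<x+h} \<times> {y<..<y+h}|lebesgue. f z) -
      (LINT z:{x'<..<x'+h} \<times> {y<..<y+h}|lebesgue. f z)\<bar>
    \<le> M * (h + \<bar>x - x'\<bar>) * h\<^sup>2"
    using *[of x x'] *[of x' x] by (cases "x \<le> x'") (auto simp: abs_minus_commute)
  then show ?thesis
    using assms(3) by (simp add: diff_divide_distrib[symmetric] divide_le_eq)
qed

lemma squares_close_y:
  assumes "weak_pd_y f g" "AE z in lebesgue. \<bar>g z\<bar> \<le> M" "0 < h"
  shows "\<bar>(LINT z:{x<..<x+h} \<times> {y<..<y+h}|lebesgue. f z) / h\<^sup>2 -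
      (LINT z:{x<..<x+h} \<times> {y'<..<y'+h}|lebesgue. f z) / h\<^sup>2\<bar>
    \<le> M * (h + \<bar>y - y'\<bar>)"
proof -
  have *: "\<bar>(LINT z:{x<..<x+h} \<times> {y<..<y+h}|lebesgue. f z) -
      (LINT z:{x<..<x+h} \<times> {y'<..<y'+h}|lebesgue. f z)\<bar>
    \<le> M * (h + \<bar>y - y'\<bar>) * h\<^sup>2" if "y \<le> y'" for y y'
    using rectangle_shift_y[OF assms(1,2), of x "x + h" y "y + h" "y' - y"] assms(3) that
    by (simp add: algebra_simps power2_eq_square)
  have "\<bar>(LINT z:{x<..<x+h} \<times> {y<..<y+h}|lebesgue. f z) -
      (LINT z:{x<..<x+h} \<times> {y'<..<y'+h}|lebesgue. f z)\<bar>
    \<le> M * (h + \<bar>y - y'\<bar>) * h\<^sup>2"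
    using *[of y y'] *[of y' y] by (cases "y \<le> y'") (auto simp: abs_minus_commute)
  then show ?thesis
    using assms(3) by (simp add: diff_divide_distrib[symmetric] divide_le_eq)
qed

text \<open>The Lebesgue differentiation theorem for the squares that have the given point as their lower left
  corner.\<close>

lemma locally_integrable_differentiation:
  assumes "locally_integrable f"
  obtains N where "N \<in> null_sets lebesgue"
    "\<And>x y. (x, y) \<notin> N \<Longrightarrow>
      ((\<lambda>h. (LINT z:{x<..<x+h} \<times> {y<..<y+h}|lebesgue. f z) / h\<^sup>2) \<longlongrightarrow> f (x, y)) (at_right 0)"
proof -
  have int: "set_integrable lebesgue (cbox a b) f" for a b
    using assms compact_cbox unfolding locally_integrable_def by blast
  then have "\<And>a b. f integrable_on cbox a b"
    using set_lebesgue_integral_eq_integral(1) by blast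
  then obtain N where N: "negligible N" and lim: "\<And>x e. \<lbrakk>x \<notin> N; 0 < e\<rbrakk> \<Longrightarrow>
      \<exists>d>0. \<forall>h. 0 < h \<and> h < d \<longrightarrow> norm (integral (cbox x (x + h *\<^sub>R One)) f /\<^sub>R h ^ DIM(real \<times> real)
          - f x) < e"
    using integrable_ccontinuous_explicit by metis
  show thesis
  proof
    show "N \<in> null_sets lebesgue" using N by (simp add: negligible_iff_null_sets)
    fix x y assume xy: "(x, y) \<notin> N"
    have One: "(One :: real \<times> real) = (1, 1)"
      by (simp add: Basis_prod_def sum.union_disjoint sum.reindex inj_on_def image_iff)
    have eq: "integral (cbox (x, y) ((x, y) + h *\<^sub>R One)) f /\<^sub>R h ^ DIM(real \<times> real)
        = (LINT z:{x<..<x+h} \<times> {y<..<y+h}|lebesgue. f z) / h\<^sup>2" for h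
    proof -
      have "set_integrable lebesgue (box (x, y) (x + h, y + h)) f"
        by (rule set_integrable_subset[OF int[of "(x, y)" "(x + h, y + h)"] _ box_subset_cbox]) simp
      then have "(LINT z:{x<..<x+h} \<times> {y<..<y+h}|lebesgue. f z)
          = integral (box (x, y) (x + h, y + h)) f"
        unfolding rectangle_eq_cbox by (rule set_lebesgue_integral_eq_integral(2))
      then show ?thesis
        by (simp only: One integral_open_interval scaleR_Pair add_Pair)
          (simp add: divide_inverse_commute power2_eq_square)
    qed
    show "((\<lambda>h. (LINT z:{x<..<x+h} \<times> {y<..<y+h}|lebesgue. f z) / h\<^sup>2) \<longlongrightarrow> f (x, y)) (at_right 0)"
    proof (rule tendstoI)
      fix e :: real assume "0 < e"
      from lim[OF xy this] show "\<forall>\<^sub>F h in at_right 0. dist ((LINT z:{x<..<x+h} \<times> {y<..<y+h}|lebesgue. f z) / h\<^sup>2) (f (x, y)) < e"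
        unfolding eq dist_norm eventually_at_right_field by auto
    qed
  qed
qed

text \<open>One null set serves for all pairs of points at once, because the averages over squares satisfy the
  estimate for every pair and converge off a single null set.\<close>

lemma weak_derivatives_bounded_imp_lipschitz:
  assumes "weak_pd_x f fx" "weak_pd_y f fy"
    "AE z in lebesgue. \<bar>fx z\<bar> \<le> Mx" "AE z in lebesgue. \<bar>fy z\<bar> \<le> My"
  obtains N where "N \<in> null_sets lebesgue"
    "\<And>x y x' y'. \<lbrakk>(x, y) \<notin> N; (x', y') \<notin> N\<rbrakk> \<Longrightarrow>
      \<bar>f (x, y) - f (x', y')\<bar> \<le> Mx * \<bar>x - x'\<bar> + My * \<bar>y - y'\<bar>"
proof -
  let ?A = "\<lambda>x y h. (LINT z:{x<..<x+h} \<times> {y<..<y+h}|lebesgue. f z) / h\<^sup>2"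
  have "locally_integrable f" using assms(1) by (simp add: weak_pd_x_def)
  then obtain N where N: "N \<in> null_sets lebesgue"
    and lim: "\<And>x y. (x, y) \<notin> N \<Longrightarrow> (?A x y \<longlongrightarrow> f (x, y)) (at_right 0)"
    by (rule locally_integrable_differentiation) iprover
  show thesis
  proof
    show "N \<in> null_sets lebesgue" by fact
    fix x y x' y' assume "(x, y) \<notin> N" "(x', y') \<notin> N"
    then have lim1: "((\<lambda>h. \<bar>?A x y h - ?A x' y' h\<bar>) \<longlongrightarrow> \<bar>f (x, y) - f (x', y')\<bar>) (at_right 0)"
      by (intro tendsto_intros lim)
    have lim2: "((\<lambda>h. Mx * (h + \<bar>x - x'\<bar>) + My * (h + \<bar>y - y'\<bar>))
        \<longlongrightarrow> Mx * (0 + \<bar>x - x'\<bar>) + My * (0 + \<bar>y - y'\<bar>)) (at_right 0)"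
      by (intro tendsto_intros)
    \<comment> \<open>Pass from one square to the other through the square at the corner \<open>(x', y)\<close>.\<close>
    have "\<bar>?A x y h - ?A x' y' h\<bar> \<le> Mx * (h + \<bar>x - x'\<bar>) + My * (h + \<bar>y - y'\<bar>)" if "0 < h" for h
      using squares_close_x[OF assms(1,3) that, of x y x'] squares_close_y[OF assms(2,4) that, of x' y y']
      by linarith
    then have le: "\<forall>\<^sub>F h in at_right 0. \<bar>?A x y h - ?A x' y' h\<bar> \<le> Mx * (h + \<bar>x
        - x'\<bar>) + My * (h + \<bar>y - y'\<bar>)"
      by (auto simp: eventually_at_filter)
    show "\<bar>f (x, y) - f (x', y')\<bar> \<le> Mx * \<bar>x - x'\<bar> + My * \<bar>y - y'\<bar>"
      using tendsto_le[OF trivial_limit_at_right_real lim2 lim1 le] by simp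
  qed
qed

section \<open>Support and iterated integrals\<close>

text \<open>By the Lindeloef property the union of all open sets on which \<open>f\<close> vanishes almost
  everywhere is already a countable union of such sets.\<close>

lemma AE_zero_outside_ess_support: "AE z in lebesgue. z \<notin> ess_support f \<longrightarrow> f z = 0"
proof -
  let ?F = "{U. open U \<and> (AE z in lebesgue. z \<in> U \<longrightarrow> f z = 0)}"
  obtain F where F: "F \<subseteq> ?F" "countable F" "\<Union>F = \<Union>?F"
    using Lindelof[of ?F] by blast
  then have "AE z in lebesgue. \<forall>U\<in>F. z \<in> U \<longrightarrow> f z = 0"
    by (subst AE_ball_countable) auto
  then show ?thesis
    unfolding ess_support_def F(3)[symmetric] by eventually_elim blast
qed

text \<open>Fubini's theorem for the completed measure. A section of a Lebesgue measurable function need not be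
  measurable, so \<open>f\<close> is replaced by a Borel function that agrees with it almost everywhere;
  almost every section of the two then agrees almost everywhere.\<close>

lemma integral_lebesgue_iterated:
  fixes f :: "real \<times> real \<Rightarrow> real"
  assumes f: "integrable lebesgue f"
  shows "(LINT x|lebesgue. LINT y|lebesgue. f (x, y)) = (LINT z|lebesgue. f z)"
proof -
  from completion_ex_borel_measurable_real[OF borel_measurable_integrable[OF f]]
  obtain g where g[measurable]: "g \<in> borel_measurable lborel" and eq: "AE z in lborel. f z = g z"
      by auto
  have "integrable lebesgue g"
    by (rule integrable_cong_AE_imp[OF f measurable_completion[OF g]]) (use eq AE_completion in force)
  then have ig: "integrable (lborel \<Otimes>\<^sub>M lborel) g"
    using g by (simp add: lborel_prod integrable_completion)
  have gb: "g \<in> borel_measurable borel" using g by simp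
  have gs: "(\<lambda>y. g (x, y)) \<in> borel_measurable borel" for x
    by (rule measurable_compose[OF _ gb]) simp
  have "AE x in lborel. AE y in lborel. f (x, y) = g (x, y)"
    using eq unfolding lborel_prod[symmetric] by (rule lborel_pair.AE_pair)
  then have inner: "AE x in lborel. (LINT y|lebesgue. f (x, y)) = (LINT y|lborel. g (x, y))"
  proof eventually_elim
    case (elim x)
    have gl: "(\<lambda>y. g (x, y)) \<in> borel_measurable lebesgue"
        by (intro measurable_completion) (use gs in simp)
    have ae: "AE y in lebesgue. g (x, y) = f (x, y)" using AE_completion[OF elim]
        by (auto elim: eventually_mono)
    have "(LINT y|lebesgue. g (x, y)) = (LINT y|lebesgue. f (x, y))"
      by (rule integral_cong_AE[OF gl borel_measurable_AE[OF gl ae] ae])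
    then show ?case using gs by (simp add: integral_completion)
  qed
  have kl: "(\<lambda>x. LINT y|lborel. g (x, y)) \<in> borel_measurable lborel"
    using ig by (intro borel_measurable_integrable lborel_pair.integrable_fst')
  note kl' = measurable_completion[OF kl]
  have inner': "AE x in lebesgue. (LINT y|lborel. g (x, y)) = (LINT y|lebesgue. f (x, y))"
    using AE_completion[OF inner] by (auto elim: eventually_mono)
  have "(LINT x|lebesgue. LINT y|lebesgue. f (x, y)) = (LINT x|lebesgue. LINT y|lborel. g (x, y))"
    by (rule integral_cong_AE[OF kl' borel_measurable_AE[OF kl' inner'] inner', symmetric])
  also have "\<dots> = (LINT x|lborel. LINT y|lborel. g (x, y))"
    using kl by (rule integral_completion)
  also have "\<dots> = (LINT z|lborel. g z)"
    using lborel_pair.integral_fst'[OF ig] by (simp add: lborel_prod)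
  also have "\<dots> = (LINT z|lebesgue. g z)"
    using g by (simp add: integral_completion)
  also have "\<dots> = (LINT z|lebesgue. f z)"
    using AE_completion[OF eq] f measurable_completion[OF g]
    by (intro integral_cong_AE) (auto elim: eventually_mono)
  finally show ?thesis .
qed

lemma cell_mean_eq:
  assumes "locally_integrable f"
  shows "cell_mean L1 L1' L2 L2' f N i j = (real N)\<^sup>2 / ((L1 - L1') * (L2 - L2')) *
    (LINT z:{grid L1' L1 N i..grid L1' L1 N (i + 1)} \<times> {grid L2' L2 N j..grid L2' L2 N (j + 1)}|lebesgue. f z)"
proof -
  have "(LINT x:{a..b}|lebesgue. LINT y:{c..d}|lebesgue. f (x, y)) =
      (LINT z:{a..b} \<times> {c..d}|lebesgue. f z)"
    for a b c d
  proof -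
    have "set_integrable lebesgue ({a..b} \<times> {c..d}) f"
      using assms compact_cbox unfolding rectangle_eq_cbox locally_integrable_def by blast
    from integral_lebesgue_iterated[OF this[unfolded set_integrable_def]] show ?thesis
      by (simp add: set_lebesgue_integral_def indicator_times mult.assoc)
  qed
  then show ?thesis unfolding cell_mean_def by simp
qed

section \<open>Replacing a function by its mean\<close>

lemma set_integral_abs_le:
  fixes F :: "real \<times> real \<Rightarrow> real"
  assumes Q: "Q \<in> lmeasurable" and F: "AE z in lebesgue. z \<in> Q \<longrightarrow> \<bar>F z\<bar> \<le> C"
  shows "\<bar>LINT z:Q|lebesgue. F z\<bar> \<le> C * measure lebesgue Q"
proof -
  have "integrable lebesgue (\<lambda>z. C * indicator Q z)"
    using Q by (auto simp: fmeasurable_def intro!: integrable_mult_right integrable_real_indicator)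
  moreover have "AE z in lebesgue. \<bar>indicator Q z *\<^sub>R F z\<bar> \<le> C * indicator Q z"
    using F by eventually_elim (auto simp: indicator_def)
  ultimately have "\<bar>LINT z|lebesgue. indicator Q z *\<^sub>R F z\<bar> \<le> (LINT z|lebesgue. C * indicator Q z)"
    by (rule abs_integral_le_AE)
  then show ?thesis by (simp add: set_lebesgue_integral_def)
qed

lemma set_integral_constant:
  fixes Q :: "(real \<times> real) set"
  assumes "Q \<in> lmeasurable"
  shows "set_integrable lebesgue Q (\<lambda>z. c :: real)" "(LINT z:Q|lebesgue. c)
      = c * measure lebesgue Q"
  using assms by (auto simp: set_integrable_def set_lebesgue_integral_def fmeasurable_def
      mult.commute intro!: integrable_mult_right integrable_real_indicator)

lemma mean_deviation_le:
  fixes f :: "real \<times> real \<Rightarrow> real"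
  assumes Q: "Q \<in> lmeasurable" "0 < measure lebesgue Q" and f: "set_integrable lebesgue Q f"
    and c: "AE w in lebesgue. w \<in> Q \<longrightarrow> \<bar>f w - v\<bar> \<le> c"
  shows "\<bar>(LINT w:Q|lebesgue. f w) / measure lebesgue Q - v\<bar> \<le> c"
proof -
  have "(LINT w:Q|lebesgue. f w - v) = (LINT w:Q|lebesgue. f w) - v * measure lebesgue Q"
    using f set_integral_constant[OF Q(1), of v] by simp
  with set_integral_abs_le[OF Q(1) c]
  have "\<bar>(LINT w:Q|lebesgue. f w) - v * measure lebesgue Q\<bar> \<le> c * measure lebesgue Q" by simp
  moreover have "(LINT w:Q|lebesgue. f w) / measure lebesgue Q - v
      = ((LINT w:Q|lebesgue. f w) - v * measure lebesgue Q) / measure lebesgue Q"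
    using Q(2) by (simp add: field_simps)
  ultimately show ?thesis using Q(2) by (simp add: divide_le_eq)
qed

text \<open>This gains one order of accuracy over the bound \<open>c\<close> for \<open>m - f\<close>: the oscillation of the
  test function enters as a second small factor.\<close>

lemma mean_replacement_le:
  fixes f \<phi> :: "real \<times> real \<Rightarrow> real"
  assumes Q: "Q \<in> lmeasurable" "0 < measure lebesgue Q"
    and int: "set_integrable lebesgue Q f" "set_integrable lebesgue Q \<phi>" 
        "set_integrable lebesgue Q (\<lambda>z. f z * \<phi> z)"
    and m: "m = (LINT z:Q|lebesgue. f z) / measure lebesgue Q"
    and f: "AE z in lebesgue. z \<in> Q \<longrightarrow> \<bar>m - f z\<bar> \<le> c" and \<phi>: "\<And>z. z \<in> Q \<Longrightarrow> \<bar>\<phi> z - e\<bar> \<le> c'"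
  shows "\<bar>m * (LINT z:Q|lebesgue. \<phi> z) - (LINT z:Q|lebesgue. f z * \<phi> z)\<bar>
      \<le> c * c' * measure lebesgue Q"
proof -
  note const = set_integral_constant[OF Q(1)]
  \<comment> \<open>Since \<open>f - m\<close> has integral 0 over \<open>Q\<close>, subtracting the constant \<open>e\<close> from \<open>\<phi>\<close> changes nothing.\<close>
  have "(LINT z:Q|lebesgue. (m - f z) * (\<phi> z - e))
      = (LINT z:Q|lebesgue. (m * \<phi> z - f z * \<phi> z) - (m * e - e * f z))"
    by (simp add: algebra_simps)
  also have "\<dots> = (LINT z:Q|lebesgue. m * \<phi> z - f z * \<phi> z) - (LINT z:Q|lebesgue. m * e - e * f z)"
    using int const by (intro set_integral_diff) auto
  also have "(LINT z:Q|lebesgue. m * \<phi> z - f z * \<phi> z) = m * (LINT z:Q|lebesgue. \<phi> z) -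
      (LINT z:Q|lebesgue. f z * \<phi> z)"
    using int by (subst set_integral_diff) auto
  also have "(LINT z:Q|lebesgue. m * e - e * f z) = m * e * measure lebesgue Q - e *
      (LINT z:Q|lebesgue. f z)"
    using int const[of "m * e"] by (subst set_integral_diff) auto
  also have "\<dots> = 0" using Q(2) by (simp add: m)
  finally have eq: "(LINT z:Q|lebesgue. (m - f z) * (\<phi> z - e))
      = m * (LINT z:Q|lebesgue. \<phi> z) - (LINT z:Q|lebesgue. f z * \<phi> z)" by simp
  have "AE z in lebesgue. z \<in> Q \<longrightarrow> \<bar>(m - f z) * (\<phi> z - e)\<bar> \<le> c * c'"
    using f
  proof eventually_elim
    case (elim z)
    show ?case
    proof
      assume "z \<in> Q"
      with elim \<phi> show "\<bar>(m - f z) * (\<phi> z - e)\<bar> \<le> c * c'"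
        unfolding abs_mult by (meson abs_ge_zero mult_mono order_trans)
    qed
  qed
  from set_integral_abs_le[OF Q(1) this] show ?thesis unfolding eq .
qed

section \<open>Integrability and half-open rectangles\<close>

lemma integrable_imp_locally_integrable:
  "integrable lebesgue f \<Longrightarrow> locally_integrable f"
  unfolding locally_integrable_def set_integrable_def
  using integrable_mult_indicator lmeasurable_compact[THEN fmeasurableD] by blast

lemma Linf_norm_nonneg: "f \<in> Linf \<Longrightarrow> 0 \<le> Linf_norm f"
proof (rule ccontr)
  assume "f \<in> Linf" "\<not> 0 \<le> Linf_norm f"
  with AE_le_Linf_norm have "AE z in lebesgue. \<bar>f z\<bar> \<le> Linf_norm f" by blast
  then have "AE z :: real \<times> real in lebesgue. False"
    by (rule eventually_mono) (use \<open>\<not> 0 \<le> Linf_norm f\<close> in linarith)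
  then have "(UNIV :: (real \<times> real) set) \<in> null_sets lebesgue"
    by (simp add: completion.AE_iff_null_sets)
  then show False
    using open_not_negligible[OF open_UNIV] negligible_iff_null_sets by blast
qed

lemma AE_rectangle_boundary:
  fixes a b c d :: real
  shows "AE z in lebesgue. z \<in> {a..b} \<times> {c..d} \<longleftrightarrow> z \<in> {a..<b} \<times> {c..<d}"
proof (rule AE_I')
  show "cbox (a, c) (b, d) - box (a, c) (b, d) \<in> null_sets lebesgue"
    using negligible_frontier_interval negligible_iff_null_sets by blast
qed (auto simp: rectangle_eq_cbox[symmetric])

lemma sets_half_open_rectangle:
  fixes a b c d :: real
  shows "{a..<b} \<times> {c..<d} \<in> sets lebesgue"
  by (intro sets_completionI_sets) (simp add: borel_Times)

section \<open>The uniform grid\<close>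

locale rectangle_grid =
  fixes L1 L1' L2 L2' :: real and N :: nat
  assumes L1: "L1' < L1" and L2: "L2' < L2" and N: "1 \<le> N"
begin

abbreviation "gx \<equiv> grid L1' L1 N"
abbreviation "gy \<equiv> grid L2' L2 N"

definition cell :: "nat \<Rightarrow> nat \<Rightarrow> (real \<times> real) set" where
  "cell i j = {gx i..<gx (i + 1)} \<times> {gy j..<gy (j + 1)}"

abbreviation mean :: "(real \<times> real \<Rightarrow> real) \<Rightarrow> nat \<Rightarrow> nat \<Rightarrow> real" where
  "mean f i j \<equiv> cell_mean L1 L1' L2 L2' f N i j"

definition mesh :: real where
  "mesh = max (L1 - L1') (L2 - L2') / real N"

lemma mesh_nonneg: "0 \<le> mesh"
  using L1 by (simp add: mesh_def)

lemma grid_step: "gx (i + 1) = gx i + (L1 - L1') / real N" "gy (j + 1) = gy j + (L2 - L2') / real N"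
  by (simp_all only: grid_def of_nat_add of_nat_1 distrib_right mult_1 add.assoc)

lemma grid_less: "gx i < gx (i + 1)" "gy j < gy (j + 1)"
  unfolding grid_step(1) grid_step(2) using L1 L2 N by simp_all

lemma step_le_mesh: "gx (i + 1) - gx i \<le> mesh" "gy (j + 1) - gy j \<le> mesh"
  unfolding grid_step(1) grid_step(2) mesh_def by (simp_all add: divide_right_mono)

lemma cell_AE_eq:
  "AE z in lebesgue. z \<in> {gx i..gx (i + 1)} \<times> {gy j..gy (j + 1)} \<longleftrightarrow> z \<in> cell i j"
  unfolding cell_def by (rule AE_rectangle_boundary)

lemma cell_sets: "cell i j \<in> sets lebesgue"
  unfolding cell_def by (rule sets_half_open_rectangle)

lemma cell_subset: "cell i j \<subseteq> {gx i..gx (i + 1)} \<times> {gy j..gy (j + 1)}"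
  by (auto simp: cell_def)

lemma cell_lmeasurable: "cell i j \<in> lmeasurable"
  by (rule fmeasurableI2[OF lmeasurable_rectangle cell_subset cell_sets])

lemma measure_cell: "measure lebesgue (cell i j) = (L1 - L1') * (L2 - L2') / (real N)\<^sup>2"
proof -
  have "measure lebesgue (cell i j) = measure lebesgue ({gx i..gx (i + 1)} \<times> {gy j..gy (j + 1)})"
    using cell_AE_eq[of i j] lmeasurable_rectangle[THEN fmeasurableD] cell_sets
    by (intro measure_eq_AE) auto
  also have "\<dots> = (gx (i + 1) - gx i) * (gy (j + 1) - gy j)"
    using grid_less(1)[of i] grid_less(2)[of j] by (intro measure_rectangle) auto
  also have "\<dots> = (L1 - L1') * (L2 - L2') / (real N)\<^sup>2"
    unfolding grid_step(1) grid_step(2) by (simp add: power2_eq_square)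
  finally show ?thesis .
qed

lemma measure_cell_pos: "0 < measure lebesgue (cell i j)"
  unfolding measure_cell using L1 L2 N by simp

lemma measure_cell_le: "measure lebesgue (cell i j) \<le> mesh\<^sup>2"
proof -
  have "(L1 - L1') * (L2 - L2') \<le> max (L1 - L1') (L2 - L2') * max (L1 - L1') (L2 - L2')"
    using L1 L2 by (intro mult_mono) auto
  then show ?thesis
    unfolding measure_cell mesh_def power_divide
        by (intro divide_right_mono) (simp_all add: power2_eq_square)
qed

lemma set_integrable_cell:
  assumes "locally_integrable f"
  shows "set_integrable lebesgue (cell i j) f"
proof (rule set_integrable_subset)
  show "set_integrable lebesgue ({gx i..gx (i + 1)} \<times> {gy j..gy (j + 1)}) f"
    using assms compact_cbox unfolding rectangle_eq_cbox locally_integrable_def by blast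
qed (rule cell_sets cell_subset)+

lemma mean_eq:
  assumes "locally_integrable f"
  shows "mean f i j = (LINT z:cell i j|lebesgue. f z) / measure lebesgue (cell i j)"
proof -
  have "(LINT z:{gx i..gx (i + 1)} \<times> {gy j..gy (j + 1)}|lebesgue. f z) =
      (LINT z:cell i j|lebesgue. f z)"
  proof (rule set_integral_cong_set)
    show "set_borel_measurable lebesgue ({gx i..gx (i + 1)} \<times> {gy j..gy (j + 1)}) f"
      "set_borel_measurable lebesgue (cell i j) f"
      unfolding set_borel_measurable_def
      using locally_integrable_measurable[OF assms] lmeasurable_rectangle[THEN fmeasurableD] cell_sets
      by (auto intro!: borel_measurable_scaleR borel_measurable_indicator)
    show "AE z in lebesgue. (z \<in> cell i j) = (z \<in> {gx i..gx (i + 1)} \<times> {gy j..gy (j + 1)})"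
      using cell_AE_eq[of i j] by eventually_elim blast
  qed
  then show ?thesis
    unfolding cell_mean_eq[OF assms] measure_cell by simp
qed

lemma sum_indicator_grid:
  assumes "\<And>i. g i \<le> (g (Suc i) :: real)"
  shows "(\<Sum>i<n. indicator {g i..<g (i + 1)} x) = (indicator {g 0..<g n} x :: real)"
proof (induction n)
  case (Suc n)
  have "g 0 \<le> g n" by (rule lift_Suc_mono_le[of g, OF assms]) simp
  moreover have "g n \<le> g (Suc n)" by (rule assms)
  ultimately have "indicator {g 0..<g n} x + indicator {g n..<g (Suc n)} x
      = (indicator {g 0..<g (Suc n)} x :: real)"
    by (simp add: indicator_def)
  with Suc show ?case by simp
qed simp

lemma sum_indicator_cell:
  "(\<Sum>i<N. \<Sum>j<N. indicator (cell i j) z) = (indicator ({L1'..<L1} \<times> {L2'..<L2}) z :: real)"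
proof -
  have "gx 0 = L1'" "gx N = L1" "gy 0 = L2'" "gy N = L2"
    using N by (simp_all add: grid_def)
  then have "(\<Sum>i<N. indicator {gx i..<gx (i + 1)} (fst z)) = (indicator {L1'..<L1} (fst z) :: real)"
    "(\<Sum>j<N. indicator {gy j..<gy (j + 1)} (snd z)) = (indicator {L2'..<L2} (snd z) :: real)"
    using sum_indicator_grid[where g = gx and n = N] sum_indicator_grid[where g = gy and n
        = N] grid_less
    by (auto simp: less_imp_le)
  then show ?thesis
    unfolding cell_def indicator_times sum_product[symmetric] by simp
qed

lemma integral_eq_sum_cells:
  fixes F :: "real \<times> real \<Rightarrow> real"
  assumes F: "integrable lebesgue F" and out: "AE z in lebesgue. z \<notin> {L1'..L1} \<times> {L2'..L2} \<longrightarrow> F z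
      = 0"
  shows "(LINT z|lebesgue. F z) = (\<Sum>i<N. \<Sum>j<N. LINT z:cell i j|lebesgue. F z)"
proof -
  have int: "integrable lebesgue (\<lambda>z. indicator (cell i j) z *\<^sub>R F z)" for i j
    by (rule integrable_mult_indicator[OF cell_sets F])
  \<comment> \<open>The cells are half-open, so they miss the upper and right edges of the rectangle, which form a null set.\<close>
  have ae: "AE z in lebesgue. F z = (\<Sum>i<N. \<Sum>j<N. indicator (cell i j) z *\<^sub>R F z)"
    using out AE_rectangle_boundary[of L1' L1 L2' L2]
  proof eventually_elim
    case (elim z)
    have "(\<Sum>i<N. \<Sum>j<N. indicator (cell i j) z *\<^sub>R F z) = (\<Sum>i<N. \<Sum>j<N. indicator (cell i j) z) * F z"
      by (simp add: sum_distrib_right)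
    also have "\<dots> = F z" 
      unfolding sum_indicator_cell using elim by (auto simp: indicator_def)
    finally show ?case by simp
  qed
  have "(LINT z|lebesgue. F z) = (LINT z|lebesgue. (\<Sum>i<N. \<Sum>j<N. indicator (cell i j) z *\<^sub>R F z))"
    by (rule integral_cong_AE[OF _ _ ae]) (intro borel_measurable_sum borel_measurable_integrable F int)+
  also have "\<dots> = (\<Sum>i<N. \<Sum>j<N. LINT z|lebesgue. indicator (cell i j) z *\<^sub>R F z)"
    by (simp only: Bochner_Integration.integral_sum Bochner_Integration.integrable_sum int)
  finally show ?thesis unfolding set_lebesgue_integral_def .
qed

lemma integral_piecewise_constant:
  assumes "locally_integrable \<phi>"
  shows "(LINT z|lebesgue. (\<Sum>i<N. \<Sum>j<N. c i j * indicator (cell i j) z) * \<phi> z)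
    = (\<Sum>i<N. \<Sum>j<N. c i j * (LINT z:cell i j|lebesgue. \<phi> z))"
proof -
  have int: "integrable lebesgue (\<lambda>z. indicator (cell i j) z * \<phi> z)" for i j
    using set_integrable_cell[OF assms] by (simp add: set_integrable_def)
  have "(LINT z|lebesgue. (\<Sum>i<N. \<Sum>j<N. c i j * indicator (cell i j) z) * \<phi> z)
      = (LINT z|lebesgue. (\<Sum>i<N. \<Sum>j<N. c i j * (indicator (cell i j) z * \<phi> z)))"
    by (simp only: sum_distrib_right mult.assoc)
  also have "\<dots> = (\<Sum>i<N. \<Sum>j<N. c i j * (LINT z|lebesgue. indicator (cell i j) z * \<phi> z))"
    by (simp only: Bochner_Integration.integral_sum Bochner_Integration.integrable_sum
        Bochner_Integration.integrable_mult_right int integral_mult_right_zero)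
  finally show ?thesis by (simp add: set_lebesgue_integral_def)
qed

lemma rho_hat_eq: "rho_hat L1 L1' L2 L2' f N z = (\<Sum>i<N. \<Sum>j<N. mean f i j * indicator (cell i j) z)"
  by (cases z) (simp add: rho_hat_def cell_def indicator_times mult.assoc)

lemma rho_omega_hat_eq: "rho_omega_hat L1 L1' L2 L2' f w N z
    = (\<Sum>i<N. \<Sum>j<N. (mean f i j * mean w i j) * indicator (cell i j) z)"
  by (cases z) (simp add: rho_omega_hat_def cell_def indicator_times mult.assoc)

lemma cell_diff_le:
  assumes "(x, y) \<in> cell i j" "(x', y') \<in> cell i j" "0 \<le> A" "0 \<le> B"
  shows "A * \<bar>x - x'\<bar> + B * \<bar>y - y'\<bar> \<le> (A + B) * mesh"
proof -
  have "\<bar>x - x'\<bar> \<le> mesh" "\<bar>y - y'\<bar> \<le> mesh"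
    using assms(1,2) step_le_mesh(1)[of i] step_le_mesh(2)[of j] by (auto simp: cell_def)
  with assms(3,4) have "A * \<bar>x - x'\<bar> + B * \<bar>y - y'\<bar> \<le> A * mesh + B * mesh"
    by (intro add_mono mult_left_mono)
  then show ?thesis by (simp add: distrib_right)
qed

text \<open>The Lipschitz bound holds for almost all pairs of points of a cell; averaging over one of the two
  points turns it into a bound for the deviation from the mean.\<close>

lemma AE_mean_deviation_le:
  assumes w: "weak_pd_x f fx" "weak_pd_y f fy" and i: "fx \<in> Linf" "fy \<in> Linf"
  shows "AE z in lebesgue. z \<in> cell i j \<longrightarrow> \<bar>mean f i j - f z\<bar> \<le> (Linf_norm fx + Linf_norm fy) * mesh"
proof -
  have f: "locally_integrable f" using w by (simp add: weak_pd_x_def)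
  obtain S where S: "S \<in> null_sets lebesgue"
    and lip: "\<And>x y x' y'. \<lbrakk>(x, y) \<notin> S; (x', y') \<notin> S\<rbrakk> \<Longrightarrow>
      \<bar>f (x, y) - f (x', y')\<bar> \<le> Linf_norm fx * \<bar>x - x'\<bar> + Linf_norm fy * \<bar>y - y'\<bar>"
    using weak_derivatives_bounded_imp_lipschitz[OF w i[THEN AE_le_Linf_norm]] by blast
  have notS: "AE z in lebesgue. z \<notin> S" using S by (rule AE_not_in)
  have diff: "\<bar>f w - f z\<bar> \<le> (Linf_norm fx + Linf_norm fy) * mesh"
    if "w \<in> cell i j" "z \<in> cell i j" "w \<notin> S" "z \<notin> S" for w z
    using that lip[of "fst w" "snd w" "fst z" "snd z"]
      cell_diff_le[of "fst w" "snd w" i j "fst z" "snd z", OF _ _ i[THEN Linf_norm_nonneg]]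
    by simp
  show ?thesis using notS
  proof eventually_elim
    case (elim z)
    show ?case
    proof
      assume z: "z \<in> cell i j"
      have "AE w in lebesgue. w \<in> cell i j \<longrightarrow> \<bar>f w - f z\<bar> \<le> (Linf_norm fx + Linf_norm fy) * mesh"
        using notS by eventually_elim (use diff z elim in blast)
      then show "\<bar>mean f i j - f z\<bar> \<le> (Linf_norm fx + Linf_norm fy) * mesh"
        unfolding mean_eq[OF f]
        by (intro mean_deviation_le cell_lmeasurable measure_cell_pos set_integrable_cell f)
    qed
  qed
qed

lemma Cc_smooth_locally_integrable:
  assumes "\<phi> \<in> Cc_smooth"
  shows "locally_integrable \<phi>"
  unfolding locally_integrable_def set_integrable_def
proof (intro allI impI)
  fix K :: "(real \<times> real) set" assume K: "compact K"
  have "integrable lborel (\<lambda>z. indicator K z *\<^sub>R \<phi> z)"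
    using borel_integrable_compact[OF K] continuous_on_subset[OF Cc_smooth_derivatives_and_bounds(1)[OF assms]] by blast
  then show "integrable lebesgue (\<lambda>z. indicator K z *\<^sub>R \<phi> z)"
    by (simp add: integrable_completion borel_measurable_integrable)
qed

lemma locally_integrable_times_test:
  assumes "locally_integrable f" and "\<phi> \<in> Cc_smooth"
  shows "integrable lebesgue (\<lambda>z. f z * \<phi> z)"
proof (rule locally_integrable_times_bounded[OF assms(1) _ Cc_smooth_derivatives_and_bounds(4)[OF assms(2)]])
  show "\<phi> \<in> borel_measurable lebesgue"
    by (rule continuous_borel_lebesgue[OF Cc_smooth_derivatives_and_bounds(1)[OF assms(2)]])
  show "compact (closure {z. \<phi> z \<noteq> 0})" using assms(2) by (simp add: Cc_smooth_def)
  show "\<phi> z = 0" if "z \<notin> closure {z. \<phi> z \<noteq> 0}" for z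
    using that closure_subset[of "{z. \<phi> z \<noteq> 0}"] by auto
qed

section \<open>Error estimates on the grid\<close>

text \<open>Four factors \<open>mesh\<close>: one each from the oscillations of \<open>f\<close> and \<open>\<phi>\<close> on the cell, and two
  from its area. As there are \<open>N\<^sup>2\<close> cells, the total error is of order \<open>N\<^sup>-\<^sup>2\<close>.\<close>

lemma cell_error_le:
  assumes w: "weak_pd_x f fx" "weak_pd_y f fy" and i: "fx \<in> Linf" "fy \<in> Linf" and \<phi>: "\<phi> \<in> Cc_smooth"
  shows "\<bar>mean f i j * (LINT z:cell i j|lebesgue. \<phi> z) - (LINT z:cell i j|lebesgue. f z * \<phi> z)\<bar>
    \<le> (Linf_norm fx + Linf_norm fy) * (Linf_norm (pd_x \<phi>) + Linf_norm (pd_y \<phi>)) * mesh ^ 4"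
proof -
  let ?M = "Linf_norm fx + Linf_norm fy" and ?P = "Linf_norm (pd_x \<phi>) + Linf_norm (pd_y \<phi>)"
  have nn: "0 \<le> Linf_norm (pd_x \<phi>)" "0 \<le> Linf_norm (pd_y \<phi>)" "0 \<le> ?M"
    using Cc_smooth_derivatives_and_bounds(5,6)[OF \<phi>, of 0] i[THEN Linf_norm_nonneg] by linarith+
  have f: "locally_integrable f" using w by (simp add: weak_pd_x_def)
  have corner: "(gx i, gy j) \<in> cell i j" using grid_less by (simp add: cell_def)
  have "\<bar>mean f i j * (LINT z:cell i j|lebesgue. \<phi> z) - (LINT z:cell i j|lebesgue. f z * \<phi> z)\<bar>
    \<le> (?M * mesh) * (?P * mesh) * measure lebesgue (cell i j)"
  proof (rule mean_replacement_le)
    show "\<bar>\<phi> z - \<phi> (gx i, gy j)\<bar> \<le> ?P * mesh" if "z \<in> cell i j" for z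
      using Cc_smooth_lipschitz[OF \<phi>, of "fst z" "snd z" "gx i" "gy j"]
        cell_diff_le[of "fst z" "snd z" i j "gx i" "gy j", OF _ corner nn(1,2)] that by simp
    show "set_integrable lebesgue (cell i j) (\<lambda>z. f z * \<phi> z)"
      by (intro set_integrable_cell integrable_imp_locally_integrable locally_integrable_times_test f \<phi>)
  qed (intro cell_lmeasurable measure_cell_pos set_integrable_cell Cc_smooth_locally_integrable f \<phi>
      mean_eq AE_mean_deviation_le w i)+
  also have "\<dots> \<le> (?M * mesh) * (?P * mesh) * mesh\<^sup>2"
    using nn mesh_nonneg by (intro mult_left_mono measure_cell_le mult_nonneg_nonneg) auto
  also have "\<dots> = ?M * ?P * mesh ^ 4"
    by (simp add: power2_eq_square power4_eq_xxxx)
  finally show ?thesis .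
qed

lemma sum_cells_C12:
  "(\<Sum>i<N. \<Sum>j<N. (Linf_norm fx + Linf_norm fy) * (Linf_norm (pd_x \<phi>) + Linf_norm (pd_y \<phi>)) * mesh ^ 4)
    = C12 L1 L1' L2 L2' fx fy \<phi> / (real N)\<^sup>2"
  using N by (simp add: C12_def mesh_def power_divide field_simps power2_eq_square power4_eq_xxxx)

lemma rho_hat_error:
  assumes w: "weak_pd_x f fx" "weak_pd_y f fy" and i: "fx \<in> Linf" "fy \<in> Linf" and \<phi>: "\<phi> \<in> Cc_smooth"
    and out: "AE z in lebesgue. z \<notin> {L1'..L1} \<times> {L2'..L2} \<longrightarrow> f z = 0"
  shows "\<bar>(LINT z|lebesgue. rho_hat L1 L1' L2 L2' f N z * \<phi> z) - (LINT z|lebesgue. f z * \<phi> z)\<bar>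
    \<le> C12 L1 L1' L2 L2' fx fy \<phi> / (real N)\<^sup>2"
proof -
  have f: "locally_integrable f" using w by (simp add: weak_pd_x_def)
  have "(LINT z|lebesgue. f z * \<phi> z) = (\<Sum>i<N. \<Sum>j<N. LINT z:cell i j|lebesgue. f z * \<phi> z)"
    using out by (intro integral_eq_sum_cells locally_integrable_times_test f \<phi>) (auto elim: eventually_mono)
  then have eq: "(LINT z|lebesgue. rho_hat L1 L1' L2 L2' f N z * \<phi> z) - (LINT z|lebesgue. f z * \<phi> z)
      = (\<Sum>i<N. \<Sum>j<N. mean f i j * (LINT z:cell i j|lebesgue. \<phi> z) -
          (LINT z:cell i j|lebesgue. f z * \<phi> z))"
    unfolding rho_hat_eq integral_piecewise_constant[OF Cc_smooth_locally_integrable[OF \<phi>]]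
    by (simp add: sum_subtractf)
  show ?thesis
    unfolding eq sum_cells_C12[symmetric]
    by (intro order_trans[OF sum_abs] sum_mono cell_error_le w i \<phi>)
qed

text \<open>The first-order term comes from bounding \<open>f (W - \<omega>) \<phi>\<close> pointwise, with \<open>W\<close> the mean of
  \<open>\<omega>\<close>. This does not exploit that \<open>W - \<omega>\<close> has integral 0 over a cell; in return the constant
  contains only the norms of \<open>f\<close> and \<open>\<phi>\<close>, not those of their derivatives.\<close>

lemma rho_omega_hat_error:
  assumes f1: "integrable lebesgue f"
    and w: "weak_pd_x f fx" "weak_pd_y f fy" and i: "fx \<in> Linf" "fy \<in> Linf" and \<phi>: "\<phi> \<in> Cc_smooth"
    and out: "AE z in lebesgue. z \<notin> {L1'..L1} \<times> {L2'..L2} \<longrightarrow> f z = 0"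
    and \<omega>: "\<omega> \<in> Linf" "weak_pd_x \<omega> \<omega>x" "weak_pd_y \<omega> \<omega>y" "\<omega>x \<in> Linf" "\<omega>y \<in> Linf"
  shows "\<bar>(LINT z|lebesgue. rho_omega_hat L1 L1' L2 L2' f \<omega> N z * \<phi> z) -
      (LINT z|lebesgue. f z * \<omega> z * \<phi> z)\<bar>
    \<le> K12 L1 L1' L2 L2' f \<omega>x \<omega>y \<phi> / real N + C12 L1 L1' L2 L2' fx fy \<phi> * Linf_norm \<omega> / (real N)\<^sup>2"
proof -
  have f: "locally_integrable f" and lw: "locally_integrable \<omega>"
    using w \<omega> by (simp_all add: weak_pd_x_def)
  have f\<omega>: "integrable lebesgue (\<lambda>z. f z * \<omega> z)"
  proof (rule Bochner_Integration.integrable_bound)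
    show "integrable lebesgue (\<lambda>z. Linf_norm \<omega> * f z)" using f1 by simp
    show "(\<lambda>z. f z * \<omega> z) \<in> borel_measurable lebesgue"
      by (intro borel_measurable_times locally_integrable_measurable f lw)
    show "AE z in lebesgue. norm (f z * \<omega> z) \<le> norm (Linf_norm \<omega> * f z)"
      using AE_le_Linf_norm[OF \<omega>(1)]
      by eventually_elim (auto simp: abs_mult mult.commute intro!: mult_right_mono)
  qed
  have f\<omega>\<phi>: "integrable lebesgue (\<lambda>z. f z * \<omega> z * \<phi> z)"
      and f\<phi>: "integrable lebesgue (\<lambda>z. f z * \<phi> z)"
    by (intro locally_integrable_times_test integrable_imp_locally_integrable f1 f\<omega> \<phi>)+
  let ?e = "(Linf_norm fx + Linf_norm fy) * (Linf_norm (pd_x \<phi>) + Linf_norm (pd_y \<phi>)) * mesh ^ 4"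
  let ?k = "(Linf_norm \<omega>x + Linf_norm \<omega>y) * mesh * Linf_norm \<phi>"
  have cell: "\<bar>mean f i j * mean \<omega> i j * (LINT z:cell i j|lebesgue. \<phi> z) -
      (LINT z:cell i j|lebesgue. f z * \<omega> z * \<phi> z)\<bar>
      \<le> ?k * (LINT z:cell i j|lebesgue. \<bar>f z\<bar>) + Linf_norm \<omega> * ?e" for i j
  proof -
    let ?W = "mean \<omega> i j" and ?Q = "cell i j"
    have "AE w in lebesgue. w \<in> ?Q \<longrightarrow> \<bar>\<omega> w - 0\<bar> \<le> Linf_norm \<omega>"
      using AE_le_Linf_norm[OF \<omega>(1)] by eventually_elim simp
    from mean_deviation_le[OF cell_lmeasurable measure_cell_pos set_integrable_cell[OF lw] this]
    have 1: "\<bar>?W\<bar> \<le> Linf_norm \<omega>" by (simp add: mean_eq[OF lw])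
    have sub: "set_integrable lebesgue ?Q (\<lambda>z. f z * \<phi> z)" 
        "set_integrable lebesgue ?Q (\<lambda>z. f z * \<omega> z * \<phi> z)"
      "set_integrable lebesgue ?Q (\<lambda>z. \<bar>f z\<bar>)"
      by (intro set_integrable_cell integrable_imp_locally_integrable f\<phi> f\<omega>\<phi> integrable_abs f1)+
    have "(LINT z:?Q|lebesgue. ?W * (f z * \<phi> z) - f z * \<omega> z * \<phi> z)
        = ?W * (LINT z:?Q|lebesgue. f z * \<phi> z) - (LINT z:?Q|lebesgue. f z * \<omega> z * \<phi> z)"
      using sub by simp
    moreover have "\<bar>LINT z:?Q|lebesgue. ?W * (f z * \<phi> z) - f z * \<omega> z * \<phi> z\<bar> \<le>
        (LINT z:?Q|lebesgue. ?k * \<bar>f z\<bar>)"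
      unfolding set_lebesgue_integral_def
    proof (rule abs_integral_le_AE)
      show "integrable lebesgue (\<lambda>z. indicator ?Q z *\<^sub>R (?k * \<bar>f z\<bar>))"
        using set_integrable_mult_right[OF sub(3)] unfolding set_integrable_def by blast
      show "AE z in lebesgue. \<bar>indicator ?Q z *\<^sub>R (?W * (f z * \<phi> z) - f z * \<omega> z * \<phi> z)\<bar>
          \<le> indicator ?Q z *\<^sub>R (?k * \<bar>f z\<bar>)"
        using AE_mean_deviation_le[OF \<omega>(2-5), of i j]
      proof eventually_elim
        case (elim z)
        show ?case
        proof (cases "z \<in> ?Q")
          case True
          with elim have "\<bar>?W - \<omega> z\<bar> * \<bar>\<phi> z\<bar> \<le> (Linf_norm \<omega>x + Linf_norm \<omega>y) * mesh * Linf_norm \<phi>"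
            using Cc_smooth_derivatives_and_bounds(4)[OF \<phi>]
                by (intro mult_mono) (auto intro: order_trans[OF abs_ge_zero])
          then have "\<bar>?W - \<omega> z\<bar> * \<bar>\<phi> z\<bar> * \<bar>f z\<bar> \<le> ?k * \<bar>f z\<bar>"
            by (rule mult_right_mono) simp
          moreover have "?W * (f z * \<phi> z) - f z * \<omega> z * \<phi> z = (?W - \<omega> z) * \<phi> z * f z"
            by (simp add: algebra_simps)
          ultimately show ?thesis using True by (simp add: abs_mult)
        qed simp
      qed
    qed
    ultimately have 2: "\<bar>?W * (LINT z:?Q|lebesgue. f z * \<phi> z) -
        (LINT z:?Q|lebesgue. f z * \<omega> z * \<phi> z)\<bar>
        \<le> ?k * (LINT z:?Q|lebesgue. \<bar>f z\<bar>)"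
      by simp
    let ?d = "mean f i j * (LINT z:?Q|lebesgue. \<phi> z) - (LINT z:?Q|lebesgue. f z * \<phi> z)"
    have "\<bar>?W\<bar> * \<bar>?d\<bar> \<le> Linf_norm \<omega> * ?e"
      by (intro mult_mono 1 cell_error_le w i \<phi>) (auto intro: Linf_norm_nonneg \<omega>)
    \<comment> \<open>Split \<open>m W - f \<omega> = W (m - f) + f (W - \<omega>)\<close>, with \<open>m\<close> the mean of \<open>f\<close> and \<open>W\<close> the mean of \<open>\<omega>\<close>.\<close>
    moreover have "mean f i j * ?W * (LINT z:?Q|lebesgue. \<phi> z) -
        (LINT z:?Q|lebesgue. f z * \<omega> z * \<phi> z)
        = ?W * ?d + (?W * (LINT z:?Q|lebesgue. f z * \<phi> z) - (LINT z:?Q|lebesgue. f z * \<omega> z * \<phi> z))"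
      by (simp add: algebra_simps)
    ultimately show ?thesis using 2 abs_mult[of ?W ?d] by linarith
  qed
  have "(LINT z|lebesgue. f z * \<omega> z * \<phi> z)
      = (\<Sum>i<N. \<Sum>j<N. LINT z:cell i j|lebesgue. f z * \<omega> z * \<phi> z)"
    using out by (intro integral_eq_sum_cells f\<omega>\<phi>) (auto elim: eventually_mono)
  then have eq: "(LINT z|lebesgue. rho_omega_hat L1 L1' L2 L2' f \<omega> N z * \<phi> z) -
      (LINT z|lebesgue. f z * \<omega> z * \<phi> z)
      = (\<Sum>i<N. \<Sum>j<N. mean f i j * mean \<omega> i j * (LINT z:cell i j|lebesgue. \<phi> z) -
          (LINT z:cell i j|lebesgue. f z * \<omega> z * \<phi> z))"
    unfolding rho_omega_hat_eq integral_piecewise_constant[OF Cc_smooth_locally_integrable[OF \<phi>]]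
    by (simp add: sum_subtractf)
  have "\<bar>\<Sum>i<N. \<Sum>j<N. mean f i j * mean \<omega> i j * (LINT z:cell i j|lebesgue. \<phi> z) -
      (LINT z:cell i j|lebesgue. f z * \<omega> z * \<phi> z)\<bar>
      \<le> (\<Sum>i<N. \<Sum>j<N. ?k * (LINT z:cell i j|lebesgue. \<bar>f z\<bar>) + Linf_norm \<omega> * ?e)"
    by (intro order_trans[OF sum_abs] sum_mono cell)
  also have "\<dots> = ?k * (\<Sum>i<N. \<Sum>j<N. LINT z:cell i j|lebesgue. \<bar>f z\<bar>) + Linf_norm \<omega> * (\<Sum>i<N. \<Sum>j<N. ?e)"
    by (simp only: sum.distrib sum_distrib_left)
  also have "(\<Sum>i<N. \<Sum>j<N. LINT z:cell i j|lebesgue. \<bar>f z\<bar>) = L1_norm f"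
    unfolding L1_norm_def
    using out by (intro integral_eq_sum_cells[symmetric] integrable_abs f1) (auto elim: eventually_mono)
  also have "?k * L1_norm f = K12 L1 L1' L2 L2' f \<omega>x \<omega>y \<phi> / real N"
    by (simp add: K12_def mesh_def)
  finally show ?thesis unfolding eq sum_cells_C12 by (simp add: mult.commute)
qed

end

section \<open>The two error bounds\<close>

theorem theorem1p1:
  fixes L1 L1' L2 L2' :: real
    and \<rho> \<rho>x \<rho>y :: "real \<times> real \<Rightarrow> real"
  assumes "L1' < L1" and "L2' < L2"
    and "integrable lebesgue \<rho>"
    and "AE z in lebesgue. \<rho> z \<ge> 0"
    and "compact (ess_support \<rho>)"
    and "ess_support \<rho> \<subseteq> {L1'..L1} \<times> {L2'..L2}"
    and "weak_pd_x \<rho> \<rho>x" and "\<rho>x \<in> Linf"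
    and "weak_pd_y \<rho> \<rho>y" and "\<rho>y \<in> Linf"
  shows "(\<forall>\<phi>\<in>Cc_smooth. \<forall>N\<ge>1.
           \<bar>(LINT z|lebesgue. rho_hat L1 L1' L2 L2' \<rho> N z * \<phi> z) - (LINT z|lebesgue. \<rho> z * \<phi> z)\<bar>
             \<le> C12 L1 L1' L2 L2' \<rho>x \<rho>y \<phi> / (real N)\<^sup>2)
       \<and> (\<forall>\<omega> \<omega>x \<omega>y. \<omega> \<in> Linf \<longrightarrow> weak_pd_x \<omega> \<omega>x \<longrightarrow> \<omega>x \<in> Linf \<longrightarrow> weak_pd_y \<omega> \<omega>y \<longrightarrow> \<omega>y \<in> Linf \<longrightarrow>
           (\<forall>\<phi>\<in>Cc_smooth. \<forall>N\<ge>1.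
             \<bar>(LINT z|lebesgue. rho_omega_hat L1 L1' L2 L2' \<rho> \<omega> N z * \<phi> z)
                - (LINT z|lebesgue. \<rho> z * \<omega> z * \<phi> z)\<bar>
               \<le> K12 L1 L1' L2 L2' \<rho> \<omega>x \<omega>y \<phi> / real N
                  + C12 L1 L1' L2 L2' \<rho>x \<rho>y \<phi> * Linf_norm \<omega> / (real N)\<^sup>2))"
proof -
  have grid: "rectangle_grid L1 L1' L2 L2' N" if "1 \<le> N" for N
    using assms(1,2) that by (rule rectangle_grid.intro)
  have out: "AE z in lebesgue. z \<notin> {L1'..L1} \<times> {L2'..L2} \<longrightarrow> \<rho> z = 0"
    using AE_zero_outside_ess_support[of \<rho>] by eventually_elim (use assms(6) in blast)
  show ?thesis
    using rectangle_grid.rho_hat_error[OF grid assms(7,9,8,10) _ out]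
      rectangle_grid.rho_omega_hat_error[OF grid assms(3,7,9,8,10) _ out]
    by blast
qed

end
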